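(* Let $n\ge 2$, $q\ge 1$, $\mathcal{D}=\mathbb{C}[D_1,\dots,D_n]$, and let $\mathcal{F}=\mathcal{C}^\infty(\mathsf{PT})_{\mathsf{fin}}[x_1,\dots,x_n]$. Let $\mathcal{M}\subset\mathcal{D}^q$ be a $\mathcal{D}$-submodule with an irredundant primary decomposition $\mathcal{M}=\mathcal{M}_1\cap\dots\cap\mathcal{M}_t$, where $\mathcal{M}_i$ is $\mathfrak{p}_i$-primary. Suppose that the variety $\mathcal{V}(\mathfrak{p}_i)\subset\mathbb{C}^n$ contains a rational point (a point of $\mathbb{Q}^n$) for $i=1,\dots,r$ and contains no rational point for $i=r+1,\dots,t$. Then the Willems closure $\mathcal{M}^{\perp\perp}$ of $\mathcal{M}$ with respect to $\mathcal{F}$ is equal to $\mathcal{M}_1\cap\dots\cap\mathcal{M}_r$ (the empty intersection being $\mathcal{D}^q$). Thus $\mathcal{M}=\mathcal{M}^{\perp\perp}$ if and only if every $\mathcal{V}(\mathfrak{p}_i)$, $i=1,\dots,t$, contains rational points.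
   Context: $\mathcal{D}=\mathbb{C}[D_1,\dots,D_n]$ is the commutative polynomial ring of constant coefficient differential operators on $\mathbb{R}^n$, with $D_j=\frac{1}{\imath}\frac{\partial}{\partial x_j}$, acting on smooth complex-valued functions on $\mathbb{R}^n$. For an ideal $\mathfrak{i}\subset\mathcal{D}$, $\mathcal{V}(\mathfrak{i})=\{a\in\mathbb{C}^n : L(a)=0 \text{ for all } L\in\mathfrak{i}\}$, where $L(a)$ is $L$ evaluated at $D_j=a_j$. $\mathcal{C}^\infty(\mathsf{PT})_{\mathsf{fin}}$ is the complex vector space of finite sums $\sum_{a\in\mathbb{Q}^n}c_a e^{\imath\langle a,x\rangle}$, $c_a\in\mathbb{C}$, with $\langle a,x\rangle=\sum_j a_jx_j$. $\mathcal{C}^\infty(\mathsf{PT})_{\mathsf{fin}}[x_1,\dots,x_n]$ is the subalgebra of $\mathcal{C}^\infty(\mathbb{R}^n)$ generated by it and the coordinate functions; its elements are the finite sums $\sum_{a\in\mathbb{Q}^n}p_a(x)e^{\imath\langle a,x\rangle}$ with $p_a\in\mathbb{C}[x_1,\dots,x_n]$. It is a $\mathcal{D}$-module. For a submodule $\mathcal{M}\subset\mathcal{D}^q$, its behavior is $\mathcal{M}^\perp=\{(f_1,\dots,f_q)\in\mathcal{F}^q : \sum_j r_j(f_j)=0 \text{ for all } (r_1,\dots,r_q)\in\mathcal{M}\}$. For a behavior $\mathcal{B}\subset\mathcal{F}^q$, $\mathcal{B}^\perp=\{(r_1,\dots,r_q)\in\mathcal{D}^q : \sum_j r_j(f_j)=0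 \text{ for all } (f_1,\dots,f_q)\in\mathcal{B}\}$. The Willems closure of $\mathcal{M}$ with respect to $\mathcal{F}$ is $\mathcal{M}^{\perp\perp}\subset\mathcal{D}^q$. For a prime ideal $\mathfrak{p}$, a submodule $\mathcal{N}\subset\mathcal{D}^q$ is $\mathfrak{p}$-primary if the set of associated primes of $\mathcal{D}^q/\mathcal{N}$ is $\{\mathfrak{p}\}$. An irredundant primary decomposition of $\mathcal{M}$ is an expression $\mathcal{M}=\mathcal{M}_1\cap\dots\cap\mathcal{M}_t$ with $\mathcal{M}_i$ $\mathfrak{p}_i$-primary, the $\mathfrak{p}_i$ pairwise distinct, no term omissible, and $\{\mathfrak{p}_1,\dots,\mathfrak{p}_t\}=\mathrm{Ass}(\mathcal{D}^q/\mathcal{M})$. *)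

theory Defs
  imports "HOL-Analysis.Analysis" "HOL-Library.Poly_Mapping"
begin

text \<open>Polynomials over \<open>\<complex>\<close> in indeterminates indexed by \<open>'n\<close>: finitely supported maps from
  exponent vectors to coefficients, multiplied by convolution.  The indeterminate with index \<open>j\<close>
  stands for the operator \<open>D\<^sub>j = (1/\<i>) \<partial>/\<partial>x\<^sub>j\<close>.\<close>

type_synonym 'n dop = "('n \<Rightarrow>\<^sub>0 nat) \<Rightarrow>\<^sub>0 complex"

definition dop_eval :: "'n::finite dop \<Rightarrow> complex ^ 'n \<Rightarrow> complex" where
  "dop_eval L a = (\<Sum>\<alpha>\<in>Poly_Mapping.keys L. Poly_Mapping.lookup L \<alpha> *
      (\<Prod>j\<in>UNIV. (a $ j) ^ Poly_Mapping.lookup \<alpha> j))"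

definition Dj :: "'n::finite \<Rightarrow> (real ^ 'n \<Rightarrow> complex) \<Rightarrow> real ^ 'n \<Rightarrow> complex" where
  "Dj j f = (\<lambda>x. (1 / \<i>) * vector_derivative (\<lambda>t. f (x + t *\<^sub>R axis j 1)) (at 0))"

text \<open>An index type carries no order, so the order in which the \<open>D\<^sub>j\<close> are composed is chosen
  arbitrarily; they commute on the signal space used here (lemma \<open>Dj_commute\<close> below).\<close>

definition coords :: "'n::finite list" where
  "coords = (SOME js. distinct js \<and> set js = UNIV)"

definition Dmono :: "('n::finite \<Rightarrow>\<^sub>0 nat) \<Rightarrow> (real ^ 'n \<Rightarrow> complex) \<Rightarrow> real ^ 'n \<Rightarrow> complex" where
  "Dmono \<alpha> f = foldr (\<lambda>j. Dj j ^^ Poly_Mapping.lookup \<alpha> j) coords f"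

definition dop_apply :: "'n::finite dop \<Rightarrow> (real ^ 'n \<Rightarrow> complex) \<Rightarrow> real ^ 'n \<Rightarrow> complex" where
  "dop_apply L f = (\<lambda>x. \<Sum>\<alpha>\<in>Poly_Mapping.keys L. Poly_Mapping.lookup L \<alpha> * Dmono \<alpha> f x)"


definition character :: "real ^ 'n \<Rightarrow> real ^ 'n::finite \<Rightarrow> complex" where
  "character a = (\<lambda>x. exp (\<i> * of_real (a \<bullet> x)))"

definition PT_fin :: "(real ^ 'n::finite \<Rightarrow> complex) set" where
  "PT_fin = {\<lambda>x. \<Sum>a\<in>A. c a * character a x | A c. finite A \<and> A \<subseteq> {a. \<forall>j. a $ j \<in> \<rat>}}"

inductive_set generated_algebra :: "('x \<Rightarrow> complex) set \<Rightarrow> ('x \<Rightarrow> complex) set"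
  for S :: "('x \<Rightarrow> complex) set" where
  gen: "f \<in> S \<Longrightarrow> f \<in> generated_algebra S"
| const: "(\<lambda>x. c) \<in> generated_algebra S"
| add: "f \<in> generated_algebra S \<Longrightarrow> g \<in> generated_algebra S \<Longrightarrow>
    (\<lambda>x. f x + g x) \<in> generated_algebra S"
| mult: "f \<in> generated_algebra S \<Longrightarrow> g \<in> generated_algebra S \<Longrightarrow>
    (\<lambda>x. f x * g x) \<in> generated_algebra S"

definition PT_fin_poly :: "(real ^ 'n::finite \<Rightarrow> complex) set" where
  "PT_fin_poly = generated_algebra (PT_fin \<union> range (\<lambda>j x. complex_of_real (x $ j)))"


lemma module_self: "module ((*) :: 'a::comm_ring_1 \<Rightarrow> 'a \<Rightarrow> 'a)"
  by unfold_locales (auto simp: algebra_simps)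

lemma module_vec: "module ((*s) :: 'a::comm_ring_1 \<Rightarrow> 'a ^ 'q \<Rightarrow> 'a ^ 'q)"
  by unfold_locales (auto simp: vec_eq_iff algebra_simps)

abbreviation is_ideal :: "'a::comm_ring_1 set \<Rightarrow> bool" where
  "is_ideal \<equiv> module.subspace (*)"

abbreviation is_submodule :: "('a::comm_ring_1 ^ 'q) set \<Rightarrow> bool" where
  "is_submodule \<equiv> module.subspace (*s)"

definition is_prime_ideal :: "'a::comm_ring_1 set \<Rightarrow> bool" where
  "is_prime_ideal p \<longleftrightarrow> is_ideal p \<and> p \<noteq> UNIV \<and> (\<forall>a b. a * b \<in> p \<longrightarrow> a \<in> p \<or> b \<in> p)"

text \<open>\<open>{r. r *s v \<in> N}\<close> is the annihilator of the class of \<open>v\<close> in the quotient by \<open>N\<close>;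
  \<open>Ass_quot N\<close> is the set of associated primes of that quotient.\<close>

definition Ass_quot :: "('a::comm_ring_1 ^ 'q) set \<Rightarrow> 'a set set" where
  "Ass_quot N = {p. is_prime_ideal p \<and> (\<exists>v. p = {r. r *s v \<in> N})}"

definition is_primary :: "'a::comm_ring_1 set \<Rightarrow> ('a ^ 'q) set \<Rightarrow> bool" where
  "is_primary p N \<longleftrightarrow> is_prime_ideal p \<and> is_submodule N \<and> Ass_quot N = {p}"

definition irredundant_primary_decomposition ::
  "('a::comm_ring_1 ^ 'q) set \<Rightarrow> nat \<Rightarrow> (nat \<Rightarrow> ('a ^ 'q) set) \<Rightarrow> (nat \<Rightarrow> 'a set) \<Rightarrow> bool" where
  "irredundant_primary_decomposition M t Mi p \<longleftrightarrow>
     M = (\<Inter>i\<in>{1..t}. Mi i) \<and>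
     (\<forall>i\<in>{1..t}. is_primary (p i) (Mi i)) \<and>
     inj_on p {1..t} \<and>
     (\<forall>k\<in>{1..t}. (\<Inter>i\<in>{1..t} - {k}. Mi i) \<noteq> M) \<and>
     p ` {1..t} = Ass_quot M"

definition variety :: "'n::finite dop set \<Rightarrow> (complex ^ 'n) set" where
  "variety I = {a. \<forall>L\<in>I. dop_eval L a = 0}"

definition has_rational_point :: "(complex ^ 'n) set \<Rightarrow> bool" where
  "has_rational_point V \<longleftrightarrow> (\<exists>a\<in>V. \<forall>j. a $ j \<in> \<rat>)"

definition behavior :: "(real ^ 'n::finite \<Rightarrow> complex) set \<Rightarrow> ('n dop ^ 'q) set \<Rightarrow>
    ((real ^ 'n \<Rightarrow> complex) ^ 'q) set" where
  "behavior F M = {f. (\<forall>j. f $ j \<in> F) \<and>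
     (\<forall>r\<in>M. \<forall>x. (\<Sum>j\<in>UNIV. dop_apply (r $ j) (f $ j) x) = 0)}"

definition behavior_perp :: "((real ^ 'n::finite \<Rightarrow> complex) ^ 'q) set \<Rightarrow> ('n dop ^ 'q) set" where
  "behavior_perp B = {r. \<forall>f\<in>B. \<forall>x. (\<Sum>j\<in>UNIV. dop_apply (r $ j) (f $ j) x) = 0}"

definition Willems_closure :: "(real ^ 'n::finite \<Rightarrow> complex) set \<Rightarrow> ('n dop ^ 'q) set \<Rightarrow>
    ('n dop ^ 'q) set" where
  "Willems_closure F M = behavior_perp (behavior F M)"


abbreviation partial_diff :: "'n::finite \<Rightarrow> (real ^ 'n \<Rightarrow> complex) \<Rightarrow> bool" where
  "partial_diff j f \<equiv> (\<forall>x. (\<lambda>t. f (x + t *\<^sub>R axis j 1)) differentiable (at 0))"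

lemma Dj_eqI:
  assumes "\<And>x. ((\<lambda>t. f (x + t *\<^sub>R axis j 1)) has_vector_derivative \<i> * g x) (at 0)"
  shows "partial_diff j f" and "Dj j f = g"
proof -
  show "partial_diff j f"
    using assms by (auto intro: differentiableI_vector)
  show "Dj j f = g"
    using vector_derivative_at[OF assms] by (auto simp: Dj_def)
qed

lemma partial_diffD:
  assumes "partial_diff j f"
  shows "((\<lambda>t. f (x + t *\<^sub>R axis j 1)) has_vector_derivative \<i> * Dj j f x) (at 0)"
  using assms by (simp add: Dj_def vector_derivative_works[symmetric])

lemma Dj_const: "partial_diff j (\<lambda>x. c)" "Dj j (\<lambda>x. c) = (\<lambda>x. 0)"
proof -
  have "((\<lambda>t. c) has_vector_derivative \<i> * 0) (at 0)" by simp
  then show "partial_diff j (\<lambda>x. c)" "Dj j (\<lambda>x. c) = (\<lambda>x. 0)"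
    by (rule Dj_eqI)+
qed

lemma Dj_add:
  assumes "partial_diff j f" "partial_diff j g"
  shows "partial_diff j (\<lambda>x. f x + g x)"
    and "Dj j (\<lambda>x. f x + g x) = (\<lambda>x. Dj j f x + Dj j g x)"
proof -
  have "((\<lambda>t. f (x + t *\<^sub>R axis j 1) + g (x + t *\<^sub>R axis j 1)) has_vector_derivative
      \<i> * (Dj j f x + Dj j g x)) (at 0)" for x
    using has_vector_derivative_add[OF partial_diffD[OF assms(1), of x] partial_diffD[OF assms(2), of x]]
    by (simp add: algebra_simps)
  then show "partial_diff j (\<lambda>x. f x + g x)"
    and "Dj j (\<lambda>x. f x + g x) = (\<lambda>x. Dj j f x + Dj j g x)"
    by (rule Dj_eqI)+
qed

lemma Dj_mult:
  assumes "partial_diff j f" "partial_diff j g"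
  shows "partial_diff j (\<lambda>x. f x * g x)"
    and "Dj j (\<lambda>x. f x * g x) = (\<lambda>x. f x * Dj j g x + Dj j f x * g x)"
proof -
  have "((\<lambda>t. f (x + t *\<^sub>R axis j 1) * g (x + t *\<^sub>R axis j 1)) has_vector_derivative
      \<i> * (f x * Dj j g x + Dj j f x * g x)) (at 0)" for x
    using has_vector_derivative_mult[OF partial_diffD[OF assms(1), of x] partial_diffD[OF assms(2), of x]]
    by (simp add: algebra_simps)
  then show "partial_diff j (\<lambda>x. f x * g x)"
    and "Dj j (\<lambda>x. f x * g x) = (\<lambda>x. f x * Dj j g x + Dj j f x * g x)"
    by (rule Dj_eqI)+
qed

lemma Dj_coord:
  "partial_diff j (\<lambda>x. complex_of_real (x $ k))"
  "Dj j (\<lambda>x. complex_of_real (x $ k)) = (\<lambda>x. if j = k then - \<i> else 0)"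
proof -
  have "((\<lambda>t. complex_of_real ((x + t *\<^sub>R axis j 1) $ k)) has_vector_derivative
      \<i> * (if j = k then - \<i> else 0)) (at 0)" for x :: "real ^ 'a"
  proof -
    have eq: "(x + t *\<^sub>R axis j 1) $ k = x $ k + t * (if j = k then 1 else 0)" for t
      by (simp add: axis_def)
    have "((\<lambda>t. x $ k + t * (if j = k then 1 else 0)) has_real_derivative
        (if j = k then 1 else 0)) (at 0)"
      by (rule derivative_eq_intros refl | simp)+
    from has_vector_derivative_of_real[OF this] show ?thesis
      unfolding eq by (simp split: if_splits)
  qed
  then show "partial_diff j (\<lambda>x. complex_of_real (x $ k))"
    "Dj j (\<lambda>x. complex_of_real (x $ k)) = (\<lambda>x. if j = k then - \<i> else 0)"
    by (rule Dj_eqI)+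
qed

lemma Dj_character:
  "partial_diff j (\<lambda>x. c * character a x)"
  "Dj j (\<lambda>x. c * character a x) = (\<lambda>x. of_real (a $ j) * c * character a x)"
proof -
  have ip: "a \<bullet> (x + t *\<^sub>R axis j 1) = a \<bullet> x + t * a $ j" for x t
    by (simp add: inner_add_right inner_axis)
  have "((\<lambda>t. c * character a (x + t *\<^sub>R axis j 1)) has_vector_derivative
      \<i> * (of_real (a $ j) * c * character a x)) (at 0)" for x
  proof -
    have "((\<lambda>z. c * exp (\<i> * (of_real (a \<bullet> x) + z * of_real (a $ j)))) has_field_derivative
        \<i> * (of_real (a $ j) * c * character a x)) (at (of_real 0))"
      unfolding character_def by (rule derivative_eq_intros refl | simp)+
    from has_vector_derivative_real_field[OF this] show ?thesis
      unfolding character_def ip by (simp add: o_def)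
  qed
  then show "partial_diff j (\<lambda>x. c * character a x)"
    "Dj j (\<lambda>x. c * character a x) = (\<lambda>x. of_real (a $ j) * c * character a x)"
    by (rule Dj_eqI)+
qed

lemma Dj_sum_character:
  assumes "finite A"
  shows "partial_diff j (\<lambda>x. \<Sum>a\<in>A. c a * character a x)"
    and "Dj j (\<lambda>x. \<Sum>a\<in>A. c a * character a x) =
      (\<lambda>x. \<Sum>a\<in>A. of_real (a $ j) * c a * character a x)"
proof -
  have "partial_diff j (\<lambda>x. \<Sum>a\<in>A. c a * character a x) \<and>
    Dj j (\<lambda>x. \<Sum>a\<in>A. c a * character a x) =
      (\<lambda>x. \<Sum>a\<in>A. of_real (a $ j) * c a * character a x)"
    using assms
  proof induction
    case empty
    show ?case by (simp add: Dj_const)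
  next
    case (insert b A)
    show ?case
      using Dj_add[OF Dj_character(1)[where j=j and c="c b" and a=b] conjunct1[OF insert.IH]] insert
        Dj_character(2)[of j "c b" b]
      by simp
  qed
  then show "partial_diff j (\<lambda>x. \<Sum>a\<in>A. c a * character a x)"
    and "Dj j (\<lambda>x. \<Sum>a\<in>A. c a * character a x) =
      (\<lambda>x. \<Sum>a\<in>A. of_real (a $ j) * c a * character a x)"
    by blast+
qed

lemma Dj_PT_fin_poly:
  assumes "f \<in> PT_fin_poly"
  shows "partial_diff j f" and "Dj j f \<in> PT_fin_poly"
proof -
  have "partial_diff j f \<and> Dj j f \<in> PT_fin_poly"
    using assms unfolding PT_fin_poly_def
  proof (induction rule: generated_algebra.induct)
    case (gen f)
    then consider "f \<in> PT_fin" | k where "f = (\<lambda>x. complex_of_real (x $ k))" by auto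
    then show ?case
    proof cases
      case 1
      then obtain A c where A: "finite A" "A \<subseteq> {a. \<forall>j. a $ j \<in> \<rat>}"
        and f: "f = (\<lambda>x. \<Sum>a\<in>A. c a * character a x)"
        unfolding PT_fin_def by blast
      have "Dj j f \<in> PT_fin"
        unfolding f Dj_sum_character(2)[OF A(1)] PT_fin_def using A
        by (intro CollectI exI[of _ A] exI[of _ "\<lambda>a. of_real (a $ j) * c a"]) auto
      then show ?thesis
        using Dj_sum_character(1)[OF A(1)] unfolding f
        by (blast intro: generated_algebra.gen)
    next
      case 2
      show ?thesis
        unfolding 2 Dj_coord(2) using Dj_coord(1)[where j=j and k=k] by (auto intro: generated_algebra.const)
    qed
  next
    case (const c)
    show ?case by (auto simp: Dj_const intro: generated_algebra.const)
  next
    case (add f g)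
    then show ?case using Dj_add[where j=j and f=f and g=g] by (auto intro: generated_algebra.add)
  next
    case (mult f g)
    then show ?case using Dj_mult[where j=j and f=f and g=g]
      by (auto intro!: generated_algebra.add generated_algebra.mult)
  qed
  then show "partial_diff j f" and "Dj j f \<in> PT_fin_poly" by blast+
qed

lemma Dj_commute:
  assumes "f \<in> PT_fin_poly"
  shows "Dj j (Dj k f) = Dj k (Dj j f)"
  using assms unfolding PT_fin_poly_def
proof (induction rule: generated_algebra.induct)
  case (gen f)
  then consider "f \<in> PT_fin" | l where "f = (\<lambda>x. complex_of_real (x $ l))" by auto
  then show ?case
  proof cases
    case 1
    then obtain A c where A: "finite A"
      and f: "f = (\<lambda>x. \<Sum>a\<in>A. c a * character a x)"
      unfolding PT_fin_def by blast
    show ?thesis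
      unfolding f Dj_sum_character(2)[OF A] by (simp add: mult_ac)
  next
    case 2
    show ?thesis unfolding 2 Dj_coord(2) Dj_const(2) ..
  qed
next
  case (const c)
  show ?case unfolding Dj_const(2) ..
next
  case (add f g)
  note F = add.hyps[folded PT_fin_poly_def]
  note D = Dj_PT_fin_poly
  show ?case
    using add.IH by (simp add: Dj_add(2) F D)
next
  case (mult f g)
  note F = mult.hyps[folded PT_fin_poly_def]
  note D = Dj_PT_fin_poly
  show ?case
    using mult.IH by (simp add: Dj_mult Dj_add(2) F D algebra_simps)
qed

lemma dop_apply_character:
  "dop_apply L (character a) = (\<lambda>x. dop_eval L (\<chi> j. of_real (a $ j)) * character a x)"
proof -
  have pow: "(Dj j ^^ m) (\<lambda>x. c * character a x) = (\<lambda>x. of_real (a $ j) ^ m * c * character a x)"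
    for j m c 
  proof (induction m)
    case (Suc m)
    then show ?case
      using Dj_character(2)[of j "of_real (a $ j) ^ m * c" a] by (simp add: mult_ac)
  qed simp
  have fold: "foldr (\<lambda>j. Dj j ^^ Poly_Mapping.lookup \<alpha> j) js (\<lambda>x. 1 * character a x) =
      (\<lambda>x. prod_list (map (\<lambda>j. of_real (a $ j) ^ Poly_Mapping.lookup \<alpha> j) js) * character a x)"
    for js \<alpha> by (induction js) (simp_all add: pow)
  have "\<exists>js :: 'a list. distinct js \<and> set js = UNIV"
    using finite_distinct_list[of "UNIV :: 'a set"] by auto
  then have "distinct (coords :: 'a list) \<and> set (coords :: 'a list) = UNIV"
    unfolding coords_def by (rule someI_ex)
  then have "Dmono \<alpha> (character a) =
      (\<lambda>x. (\<Prod>j\<in>UNIV. of_real (a $ j) ^ Poly_Mapping.lookup \<alpha> j) * character a x)" for \<alpha>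
    using fold[of \<alpha> coords]
      prod.distinct_set_conv_list[of coords "\<lambda>j. complex_of_real (a $ j) ^ Poly_Mapping.lookup \<alpha> j"]
    unfolding Dmono_def by simp
  then show ?thesis
    unfolding dop_apply_def dop_eval_def by (simp add: sum_distrib_right mult.assoc)
qed

end

theory Submission
  imports Defs
begin

text \<open>A signal is a finite sum of polynomial-exponential functions with rational frequencies \<open>a\<close>.
  The component at \<open>a\<close> is annihilated by a power of the maximal ideal \<open>m\<^sub>a\<close> of \<open>a\<close>, so
  it sees \<open>M\<close> only through its localisation at \<open>m\<^sub>a\<close>, which keeps exactly the primary components \<open>M\<^sub>i\<close> with \<open>a\<close> in the variety of
  \<open>p\<^sub>i\<close>.  If \<open>v\<close> lies in \<open>M\<^sub>1, \<dots>, M\<^sub>r\<close>, then for every rational \<open>a\<close> some \<open>s\<close> with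
  \<open>s(a) \<noteq> 0\<close> carries \<open>v\<close> into \<open>M\<close>, and a signal annihilated by such an \<open>s\<close> for every \<open>a\<close> is
  zero.  Conversely, if \<open>v\<close> is not in \<open>M\<^sub>i\<close> and \<open>p\<^sub>i\<close> vanishes at a rational \<open>a\<close>, then a linear functional
  that vanishes on \<open>M\<^sub>i\<close> and on a power of \<open>m\<^sub>a\<close> but not at \<open>v\<close> is the Taylor data of a
  signal that \<open>M\<^sub>i\<close> annihilates and \<open>v\<close> does not.\<close>

lemmas submodule_0 = module.subspace_0[OF module_vec]
  and submodule_add = module.subspace_add[OF module_vec]
  and submodule_scale = module.subspace_scale[OF module_vec]
  and submodule_diff = module.subspace_diff[OF module_vec]
  and submoduleI = module.subspaceI[OF module_vec]

lemmas ideal_0 = module.subspace_0[OF module_self]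
  and ideal_add = module.subspace_add[OF module_self]
  and ideal_scale = module.subspace_scale[OF module_self]
  and ideal_sum = module.subspace_sum[OF module_self]
  and idealI = module.subspaceI[OF module_self]

section \<open>The ascending chain condition\<close>

text \<open>Induction over the coordinates: a monotone subsequence is chosen for the new one, and
  thinning out preserves the earlier ones. If it is decreasing, it attains its least value and is
  constant from there on, so its tail is increasing as well.\<close>

lemma monotone_subsequence:
  fixes a :: "nat \<Rightarrow> 's \<Rightarrow> nat"
  assumes "finite S"
  shows "\<exists>r. strict_mono r \<and> (\<forall>s\<in>S. incseq (\<lambda>i. a (r i) s))"
  using assms
proof induction
  case empty
  show ?case by (auto intro: exI[of _ id] simp: strict_mono_def)
next
  case (insert x S)
  then obtain r where r: "strict_mono r" "\<forall>s\<in>S. incseq (\<lambda>i. a (r i) s)" by blast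
  obtain f where f: "strict_mono f" "monoseq (\<lambda>i. a (r (f i)) x)"
    using seq_monosub[of "\<lambda>i. a (r i) x"] by blast
  have "\<exists>g. strict_mono g \<and> incseq (\<lambda>i. a (r (f (g i))) x)"
  proof (cases "incseq (\<lambda>i. a (r (f i)) x)")
    case True
    then show ?thesis by (intro exI[of _ id]) (auto simp: strict_mono_def)
  next
    case False
    with f have dec: "decseq (\<lambda>i. a (r (f i)) x)" by (simp add: monoseq_iff)
    define m where "m = (LEAST m. m \<in> range (\<lambda>i. a (r (f i)) x))"
    have "m \<in> range (\<lambda>i. a (r (f i)) x)"
      unfolding m_def by (rule LeastI_ex) blast
    then obtain k where k: "m = a (r (f k)) x" by blast
    have "a (r (f (i + k))) x = m" for i
    proof (rule antisym)
      show "a (r (f (i + k))) x \<le> m"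
        using decseqD[OF dec, of k "i + k"] by (simp add: k)
      show "m \<le> a (r (f (i + k))) x"
        unfolding m_def by (rule Least_le) blast
    qed
    then show ?thesis
      by (intro exI[of _ "\<lambda>i. i + k"]) (auto simp: strict_mono_def incseq_def)
  qed
  then obtain g where g: "strict_mono g" "incseq (\<lambda>i. a (r (f (g i))) x)" by blast
  have sm: "strict_mono (\<lambda>i. f (g i))" using f(1) g(1) by (simp add: strict_mono_def)
  have "incseq (\<lambda>i. a (r (f (g i))) s)" if "s \<in> S" for s
    using r(2) that strict_mono_mono[OF sm] by (auto simp: incseq_def mono_def)
  with g sm r(1) show ?case
    by (intro exI[of _ "\<lambda>i. r (f (g i))"]) (auto simp: strict_mono_def)
qed

text \<open>Dickson's lemma, read off from two consecutive terms of a subsequence that increases in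
  every coordinate.\<close>

lemma dickson:
  fixes a :: "nat \<Rightarrow> 's::finite \<Rightarrow> nat"
  shows "\<exists>i j. i < j \<and> (\<forall>s. a i s \<le> a j s)"
proof -
  obtain r where r: "strict_mono r" "\<forall>s. incseq (\<lambda>i. a (r i) s)"
    using monotone_subsequence[of UNIV a] by auto
  have "r 0 < r 1" "\<forall>s. a (r 0) s \<le> a (r 1) s"
    using r by (auto simp: strict_mono_def incseq_def)
  then show ?thesis by blast
qed

text \<open>Unique factorisation makes \<open>e \<mapsto> \<Prod>\<^sub>s P\<^sub>s ^ e\<^sub>s\<close>, with distinct primes \<open>P\<^sub>s\<close>,
  injective: comparing these numbers is a monomial order, although the index type has no order.\<close>

lemma monomial_weight:
  "\<exists>W :: ('s::finite \<Rightarrow> nat) \<Rightarrow> nat. inj W \<and> (\<forall>e. 0 < W e) \<and>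
     (\<forall>e f. W (\<lambda>s. e s + f s) = W e * W f)"
proof -
  obtain Q where Q: "Q \<subseteq> {p::nat. prime p}" "finite Q" "card Q = CARD('s)"
    using infinite_arbitrarily_large[OF primes_infinite] by blast
  then obtain P :: "'s \<Rightarrow> nat" where P: "bij_betw P UNIV Q"
    using finite_same_card_bij[of "UNIV :: 's set" Q] by auto
  define W where "W e = (\<Prod>s\<in>UNIV. P s ^ e s)" for e :: "'s \<Rightarrow> nat"
  have prime: "prime (P s)" for s
    using Q(1) P by (auto simp: bij_betw_def)
  have injP: "inj P" using P by (simp add: bij_betw_def)
  have mult: "multiplicity (P s) (W e) = e s" for s e
  proof -
    have "W e = (\<Prod>p\<in>Q. p ^ e (inv P p))"
      using prod.reindex_bij_betw[OF P, of "\<lambda>p. p ^ e (inv P p)"] injP by (simp add: W_def)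
    then show ?thesis
      using multiplicity_prod_prime_powers[of Q "P s" "\<lambda>p. e (inv P p)"] Q(1,2) prime
        bij_betw_apply[OF P, of s] injP by auto
  qed
  have "inj W"
    by (rule injI) (metis mult ext)
  moreover have "0 < W e" for e
    unfolding W_def using prime by (auto simp: prod_pos prime_gt_0_nat)
  moreover have "W (\<lambda>s. e s + f s) = W e * W f" for e f
    by (simp add: W_def power_add prod.distrib)
  ultimately show ?thesis by blast
qed

lemma lookup_single_times:
  fixes p :: "('a::cancel_comm_monoid_add) \<Rightarrow>\<^sub>0 'b::comm_semiring_1"
  shows "Poly_Mapping.lookup (Poly_Mapping.single \<beta> c * p) (\<beta> + \<alpha>) =
    c * Poly_Mapping.lookup p \<alpha>"
  by (simp add: lookup_mult lookup_single when_mult)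

lemma lookup_single_times_nonzero:
  fixes p :: "('a::cancel_comm_monoid_add) \<Rightarrow>\<^sub>0 'b::comm_semiring_1"
  assumes "Poly_Mapping.lookup (Poly_Mapping.single \<beta> c * p) \<gamma> \<noteq> 0"
  obtains \<alpha> where "\<gamma> = \<beta> + \<alpha>" "Poly_Mapping.lookup p \<alpha> \<noteq> 0"
proof -
  have "\<gamma> \<in> Poly_Mapping.keys (Poly_Mapping.single \<beta> c * p)"
    using assms by (simp add: in_keys_iff)
  then obtain b \<alpha> where "\<gamma> = b + \<alpha>" "b \<in> Poly_Mapping.keys (Poly_Mapping.single \<beta> c)"
    "\<alpha> \<in> Poly_Mapping.keys p"
    using keys_mult by blast
  then show ?thesis
    using that by (cases "c = 0") (auto simp: in_keys_iff)
qed

text \<open>Hilbert's basis theorem by leading terms. In a strictly increasing chain pick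
  \<open>v i\<close> in \<open>N (Suc i)\<close> but not in \<open>N i\<close> with least leading
  monomial. Dickson's lemma gives \<open>i < j\<close> such that the leading monomial of
  \<open>v i\<close> divides that of \<open>v j\<close>; cancelling it contradicts the choice of
  \<open>v j\<close>.\<close>

lemma submodule_acc:
  "wf {(J, I). is_submodule I \<and> is_submodule J \<and> I \<subset> (J :: ('n::finite dop ^ 'q::finite) set)}"
  unfolding wf_iff_no_infinite_down_chain
proof
  assume "\<exists>N. \<forall>i. (N (Suc i), N i) \<in>
    {(J, I). is_submodule I \<and> is_submodule J \<and> I \<subset> (J :: ('n dop ^ 'q) set)}"
  then obtain N :: "nat \<Rightarrow> ('n dop ^ 'q) set"
    where N: "\<forall>i. (N (Suc i), N i) \<in> {(J, I). is_submodule I \<and> is_submodule J \<and> I \<subset> J}" ..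
  then have sub: "\<And>i. is_submodule (N i)" and chain: "\<And>i. N i \<subset> N (Suc i)"
    by auto
  obtain W :: "('n + 'q \<Rightarrow> nat) \<Rightarrow> nat" where W: "inj W" "\<And>e. 0 < W e"
    "\<And>e f. W (\<lambda>s. e s + f s) = W e * W f"
    using monomial_weight[where 's = "'n + 'q"] by blast
  \<comment> \<open>The component index is encoded as a unit vector in extra coordinates, so a
    coordinatewise comparison of two codes forces equal components.\<close>
  define enc where "enc \<alpha> l = case_sum (Poly_Mapping.lookup \<alpha>) (\<lambda>m. if l = m then 1 else 0)"
    for \<alpha> :: "'n \<Rightarrow>\<^sub>0 nat" and l :: 'q
  define key where "key \<alpha> l = W (enc \<alpha> l)" for \<alpha> l
  have key_inj: "\<alpha> = \<alpha>' \<and> l = l'" if "key \<alpha> l = key \<alpha>' l'" for \<alpha> \<alpha>' l l'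
  proof -
    have eq: "enc \<alpha> l = enc \<alpha>' l'" using injD[OF W(1)] that by (simp add: key_def)
    have "\<alpha> = \<alpha>'" using fun_cong[OF eq, of "Inl _"] by (intro poly_mapping_eqI) (simp add: enc_def)
    moreover have "l = l'" using fun_cong[OF eq, of "Inr l"] by (simp add: enc_def split: if_splits)
    ultimately show ?thesis ..
  qed
  \<comment> \<open>Multiplying by a monomial scales all keys by one positive factor and so
    preserves their order.\<close>
  have key_add: "key (\<beta> + \<alpha>) l = W (case_sum (Poly_Mapping.lookup \<beta>) (\<lambda>_. 0)) * key \<alpha> l"
    for \<alpha> \<beta> l
  proof -
    have "enc (\<beta> + \<alpha>) l = (\<lambda>s. case_sum (Poly_Mapping.lookup \<beta>) (\<lambda>_. 0) s + enc \<alpha> l s)"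
      by (auto simp: enc_def fun_eq_iff lookup_add split: sum.splits)
    then show ?thesis by (simp add: key_def W(3))
  qed
  define supp where "supp v = (SIGMA l:UNIV. Poly_Mapping.keys (v $ l))" for v :: "'n dop ^ 'q"
  have fin: "finite (supp v)" for v by (simp add: supp_def)
  define deg where "deg v = Max ((\<lambda>(l, \<alpha>). key \<alpha> l) ` supp v)" for v
  have "\<exists>v. (v \<in> N (Suc i) \<and> v \<notin> N i) \<and> (\<forall>w. w \<in> N (Suc i) \<and> w \<notin> N i \<longrightarrow> deg v \<le> deg w)" for i
    using chain[of i]
      ex_has_least_nat[of "\<lambda>v. v \<in> N (Suc i) \<and> v \<notin> N i" _ deg] by blast
  then obtain v where v: "\<And>i. v i \<in> N (Suc i)" "\<And>i. v i \<notin> N i"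
    and least: "\<And>i w. w \<in> N (Suc i) \<Longrightarrow> w \<notin> N i \<Longrightarrow> deg (v i) \<le> deg w"
    by metis
  \<comment> \<open>Elements outside a submodule are nonzero, so the maximum in \<open>deg\<close>
    is taken over a nonempty set.\<close>
  have nonempty: "supp w \<noteq> {}" if "w \<notin> N i" for i w
  proof
    assume "supp w = {}"
    then have "w $ l = 0" for l by (auto simp: supp_def simp flip: keys_eq_empty)
    then have "w = 0" by (simp add: vec_eq_iff)
    with that submodule_0[OF sub] show False by blast
  qed
  have "\<exists>l \<alpha>. (l, \<alpha>) \<in> supp (v i) \<and> key \<alpha> l = deg (v i)" for i
  proof -
    have "deg (v i) \<in> (\<lambda>(l, \<alpha>). key \<alpha> l) ` supp (v i)"
      unfolding deg_def using fin nonempty[OF v(2)[of i]] by (intro Max_in) auto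
    then show ?thesis by force
  qed
  then obtain l \<alpha> where lead: "\<And>i. (l i, \<alpha> i) \<in> supp (v i)" "\<And>i. key (\<alpha> i) (l i) = deg (v i)"
    by metis
  obtain i j where ij: "i < j" "\<And>s. enc (\<alpha> i) (l i) s \<le> enc (\<alpha> j) (l j) s"
  proof -
    have "\<exists>i j. i < j \<and> (\<forall>s. enc (\<alpha> i) (l i) s \<le> enc (\<alpha> j) (l j) s)" by (rule dickson)
    then show ?thesis by (elim exE conjE) (rule that, assumption, erule spec)
  qed
  have l: "l i = l j" using ij(2)[of "Inr (l i)"] by (simp add: enc_def split: if_splits)
  define \<beta> where "\<beta> = \<alpha> j - \<alpha> i"
  have \<beta>: "\<alpha> j = \<beta> + \<alpha> i"
  proof (rule poly_mapping_eqI)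
    fix k
    show "Poly_Mapping.lookup (\<alpha> j) k = Poly_Mapping.lookup (\<beta> + \<alpha> i) k"
    proof -
      have "enc (\<alpha> i) (l i) (Inl k) \<le> enc (\<alpha> j) (l j) (Inl k)" by (rule ij(2))
      then have le: "Poly_Mapping.lookup (\<alpha> i) k \<le> Poly_Mapping.lookup (\<alpha> j) k"
        unfolding enc_def sum.case .
      show ?thesis unfolding \<beta>_def lookup_add lookup_minus using le by (rule le_add_diff_inverse2[symmetric])
    qed
  qed
  \<comment> \<open>The ratio of the leading coefficients makes \<open>u\<close> agree with
    \<open>v j\<close> in its leading term, which cancels in \<open>w\<close>.\<close>
  define c where "c = Poly_Mapping.lookup (v j $ l j) (\<alpha> j) / Poly_Mapping.lookup (v i $ l i) (\<alpha> i)"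
  define u where "u = Poly_Mapping.single \<beta> c *s v i"
  define w where "w = v j - u"
  have mono: "N a \<subseteq> N b" if "a \<le> b" for a b
    by (rule lift_Suc_mono_le[OF _ that]) (rule psubset_imp_subset[OF chain])
  have u: "u \<in> N j"
    unfolding u_def using v(1)[of i] mono[of "Suc i" j] ij(1) by (intro submodule_scale[OF sub]) auto
  then have w1: "w \<in> N (Suc j)"
    unfolding w_def using v(1) mono[of j "Suc j"] by (intro submodule_diff[OF sub]) auto
  have w2: "w \<notin> N j"
  proof
    assume "w \<in> N j"
    from submodule_add[OF sub this u] have "v j \<in> N j" by (simp add: w_def)
    with v(2) show False by blast
  qed
  have lead_w: "Poly_Mapping.lookup (w $ l j) (\<alpha> j) = 0"
    using lead(1)[of i] l
    by (simp add: w_def u_def lookup_minus \<beta> lookup_single_times c_def supp_def in_keys_iff)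
  have le: "key \<gamma> m \<le> deg x" if "(m, \<gamma>) \<in> supp x" for \<gamma> m x
    unfolding deg_def using that fin by (intro Max_ge) auto
  have small: "key \<gamma> m < deg (v j)" if "(m, \<gamma>) \<in> supp w" for \<gamma> m
  proof -
    have "key \<gamma> m \<le> deg (v j)"
    proof (cases "(m, \<gamma>) \<in> supp (v j)")
      case True
      then show ?thesis by (rule le)
    next
      case False
      with that have "Poly_Mapping.lookup (Poly_Mapping.single \<beta> c * v i $ m) \<gamma> \<noteq> 0"
        by (simp add: supp_def w_def u_def in_keys_iff lookup_minus)
      then obtain \<delta> where \<delta>: "\<gamma> = \<beta> + \<delta>" "Poly_Mapping.lookup (v i $ m) \<delta> \<noteq> 0"
        by (rule lookup_single_times_nonzero)
      have "key \<delta> m \<le> key (\<alpha> i) (l i)"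
        unfolding lead(2) using \<delta>(2) by (intro le) (simp add: supp_def in_keys_iff)
      then show ?thesis
        unfolding \<delta>(1) lead(2)[symmetric] \<beta> key_add l by simp
    qed
    moreover have "key \<gamma> m \<noteq> deg (v j)"
    proof
      assume "key \<gamma> m = deg (v j)"
      then have "\<gamma> = \<alpha> j \<and> m = l j" by (intro key_inj) (simp add: lead(2))
      with that lead_w show False by (simp add: supp_def in_keys_iff)
    qed
    ultimately show ?thesis by simp
  qed
  have "deg w < deg (v j)"
    unfolding deg_def[of w] using fin nonempty[OF w2] small by (subst Max_less_iff) auto
  with least[OF w1 w2] show False by simp
qed

lemma submodule_chain_stabilizes:
  fixes N :: "nat \<Rightarrow> ('n::finite dop ^ 'q::finite) set"
  assumes "\<And>k. is_submodule (N k)" and "\<And>k. N k \<subseteq> N (Suc k)"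
  shows "\<exists>k. N (Suc k) = N k"
proof (rule ccontr)
  assume "\<nexists>k. N (Suc k) = N k"
  with assms have "\<forall>i. (N (Suc i), N i) \<in> {(J, I). is_submodule I \<and> is_submodule J \<and> I \<subset> J}"
    by blast
  with submodule_acc[where 'n='n and 'q='q] show False
    unfolding wf_iff_no_infinite_down_chain by blast
qed

text \<open>An ideal is encoded as the submodule of vectors of length one with entries in
  it.\<close>

lemma ideal_acc:
  "wf {(J, I). is_ideal I \<and> is_ideal J \<and> I \<subset> (J :: 'n::finite dop set)}"
proof (rule wf_subset[OF wf_inv_image[OF submodule_acc[where 'q = 1],
      of "\<lambda>I. {v. \<forall>l. v $ l \<in> I}"]], rule subsetI)
  fix z :: "'n dop set \<times> 'n dop set"
  assume "z \<in> {(J, I). is_ideal I \<and> is_ideal J \<and> I \<subset> J}"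
  then obtain J I where z: "z = (J, I)" and IJ: "is_ideal I" "is_ideal J" "I \<subset> J" by blast
  have sub: "is_submodule {v :: 'n dop ^ 1. \<forall>l. v $ l \<in> I}" if "is_ideal I" for I :: "'n dop set"
    using that by (intro submoduleI) (auto intro: ideal_0 ideal_add ideal_scale)
  obtain x where "x \<in> J" "x \<notin> I" using IJ(3) by blast
  then have "vec x \<in> {v :: 'n dop ^ 1. \<forall>l. v $ l \<in> J}" "vec x \<notin> {v :: 'n dop ^ 1. \<forall>l. v $ l \<in> I}"
    by simp_all
  with sub IJ show "z \<in> inv_image {(J, I). is_submodule I \<and> is_submodule J \<and> I \<subset> (J :: ('n dop ^ 1) set)}
    (\<lambda>I. {v. \<forall>l. v $ l \<in> I})"
    unfolding z in_inv_image by blast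
qed

section \<open>Primary submodules\<close>

lemma ideal_annihilator:
  assumes "is_submodule (N :: ('a::comm_ring_1 ^ 'q) set)"
  shows "is_ideal {r. r *s v \<in> N}"
proof (rule idealI)
  show "0 \<in> {r. r *s v \<in> N}" using submodule_0[OF assms] by simp
  show "x + y \<in> {r. r *s v \<in> N}" if "x \<in> {r. r *s v \<in> N}" "y \<in> {r. r *s v \<in> N}" for x y
    using submodule_add[OF assms, of "x *s v" "y *s v"] that by (simp add: vector_sadd_rdistrib)
  show "c * x \<in> {r. r *s v \<in> N}" if "x \<in> {r. r *s v \<in> N}" for c x
    using submodule_scale[OF assms, of "x *s v" c] that by (simp add: vector_smult_assoc)
qed

lemma submodule_scale_swap:
  assumes "is_submodule (N :: ('a::comm_ring_1 ^ 'q) set)" "r *s x \<in> N"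
  shows "r *s (c *s x) \<in> N"
  using submodule_scale[OF assms, of c] by (simp add: vector_smult_assoc mult.commute)

text \<open>An annihilator that is maximal among those of the elements outside \<open>N\<close> with no power of
  \<open>s\<close> carrying them into \<open>N\<close> is prime.\<close>

lemma associated_prime_avoiding:
  fixes N :: "('n::finite dop ^ 'q::finite) set"
  assumes N: "is_submodule N" and v: "\<And>k. s ^ k *s v \<notin> N"
  shows "\<exists>P\<in>Ass_quot N. s \<notin> P \<and> {r. r *s v \<in> N} \<subseteq> P"
proof -
  define ann where "ann x = {r. r *s x \<in> N}" for x
  \<comment> \<open>Only multiples of \<open>v\<close> compete, so that every annihilator in
    \<open>S\<close> contains that of \<open>v\<close>.\<close>
  define S where "S = {ann x | x. (\<forall>k. s ^ k *s x \<notin> N) \<and> (\<exists>u. x = u *s v)}"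
  have "ann v \<in> S" unfolding S_def using v by (force intro: exI[of _ 1])
  then obtain I where I: "I \<in> S" "\<And>J. (J, I) \<in> {(J, I). is_ideal I \<and> is_ideal J \<and> I \<subset> J} \<Longrightarrow> J \<notin> S"
    by (rule wfE_min[OF ideal_acc]) (rule that)
  then obtain x u where x: "I = ann x" "\<And>k. s ^ k *s x \<notin> N" "x = u *s v" unfolding S_def by blast
  have ideal: "is_ideal (ann y)" for y unfolding ann_def by (rule ideal_annihilator[OF N])
  have max: "ann y = ann x" if "ann x \<subseteq> ann y" "\<And>k. s ^ k *s y \<notin> N" "\<exists>u. y = u *s v" for y
    using that I(2)[of "ann y"] ideal unfolding x(1) S_def by blast
  \<comment> \<open>By maximality, powers of \<open>s\<close> do not enlarge the annihilator.
    Primality follows: if \<open>a * b\<close> kills \<open>x\<close> and \<open>b\<close> does not,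
    then \<open>ann (a *s x)\<close> is strictly larger, so some power of \<open>s\<close> kills
    \<open>a *s x\<close>, and then \<open>a\<close> already kills \<open>x\<close>.\<close>
  have sx: "ann (s ^ k *s x) = ann x" for k
  proof (rule max)
    show "ann x \<subseteq> ann (s ^ k *s x)"
      unfolding ann_def using submodule_scale_swap[OF N] by blast
    show "s ^ j *s (s ^ k *s x) \<notin> N" for j
      using x(2)[of "j + k"] by (simp add: vector_smult_assoc power_add)
    show "\<exists>u. s ^ k *s x = u *s v" unfolding x(3) by (auto simp: vector_smult_assoc)
  qed
  have prime: "b \<in> ann x" if ab: "a * b \<in> ann x" and a: "a \<notin> ann x" for a b
  proof (rule ccontr)
    assume b: "b \<notin> ann x"
    have sub: "ann x \<subseteq> ann (a *s x)"
      unfolding ann_def using submodule_scale_swap[OF N] by blast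
    have "b \<in> ann (a *s x)" using ab by (simp add: ann_def vector_smult_assoc mult.commute)
    with b have "ann (a *s x) \<noteq> ann x" by blast
    moreover have "\<exists>u. a *s x = u *s v" unfolding x(3) by (auto simp: vector_smult_assoc)
    ultimately obtain k where "s ^ k *s (a *s x) \<in> N" using max[OF sub] by blast
    then have "a \<in> ann (s ^ k *s x)" by (simp add: ann_def vector_smult_assoc mult.commute)
    with sx a show False by blast
  qed
  have "s \<notin> ann x" "1 \<notin> ann x" using x(2)[of 1] x(2)[of 0] by (auto simp: ann_def)
  then have "is_prime_ideal (ann x)" "s \<notin> ann x"
    using ideal[of x] prime unfolding is_prime_ideal_def by blast+
  then have "ann x \<in> Ass_quot N"
    unfolding Ass_quot_def ann_def by blast
  moreover have "{r. r *s v \<in> N} \<subseteq> ann x"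
    unfolding ann_def x(3) using submodule_scale_swap[OF N] by blast
  ultimately show ?thesis using \<open>s \<notin> ann x\<close> by blast
qed

text \<open>With \<open>s = 1\<close> the avoiding condition just says that \<open>v\<close> is
  outside \<open>N\<close>, and the only associated prime available is \<open>P\<close>.\<close>

lemma primary_annihilator_subset:
  fixes N :: "('n::finite dop ^ 'q::finite) set"
  assumes "is_primary P N" "v \<notin> N"
  shows "{r. r *s v \<in> N} \<subseteq> P"
proof -
  have N: "is_submodule N" "Ass_quot N = {P}" using assms(1) by (simp_all add: is_primary_def)
  have "1 ^ k *s v \<notin> N" for k using assms(2) by simp
  from associated_prime_avoiding[OF N(1) this] show ?thesis unfolding N(2) by blast
qed

text \<open>Otherwise some associated prime would omit \<open>s\<close>, but \<open>P\<close> is the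
  only one.\<close>

lemma primary_power_in:
  fixes N :: "('n::finite dop ^ 'q::finite) set"
  assumes "is_primary P N" "s \<in> P"
  shows "\<exists>k. s ^ k *s v \<in> N"
proof (rule ccontr)
  assume "\<nexists>k. s ^ k *s v \<in> N"
  then have v: "s ^ k *s v \<notin> N" for k by blast
  have N: "is_submodule N" "Ass_quot N = {P}" using assms(1) by (simp_all add: is_primary_def)
  from associated_prime_avoiding[OF N(1) v] show False unfolding N(2) using assms(2) by blast
qed

section \<open>The signal space as a module over the ring of operators\<close>

lemma poly_mapping_add_induct [case_names zero single add]:
  assumes "P 0" and "\<And>a c. P (Poly_Mapping.single a c)" and "\<And>f g. P f \<Longrightarrow> P g \<Longrightarrow> P (f + g)"
  shows "P (f :: 'a \<Rightarrow>\<^sub>0 'b::comm_monoid_add)"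
proof (induction f rule: update_induct)
  case const
  show ?case by (rule assms(1))
next
  case (update f a b)
  have "Poly_Mapping.update a b f = Poly_Mapping.single a b + f"
    using update.hyps
    by (intro poly_mapping_eqI) (auto simp: lookup_update lookup_add lookup_single in_keys_iff when_def)
  then show ?case using assms(2,3) update.IH by simp
qed

definition scal :: "complex \<Rightarrow> 'n dop" where
  "scal c = Poly_Mapping.single 0 c"

definition indet :: "'n \<Rightarrow> 'n dop" where
  "indet j = Poly_Mapping.single (Poly_Mapping.single j 1) 1"

lemma scal_add: "scal (c + d) = scal c + scal d"
  by (simp add: scal_def single_add)

lemma scal_mult: "scal (c * d) = scal c * scal d"
  by (simp add: scal_def mult_single)

lemma scal_1 [simp]: "scal 1 = 1"
  by (simp add: scal_def)

lemma scal_0 [simp]: "scal 0 = 0"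
  by (simp add: scal_def)

text \<open>Reduces statements about operators to constants, a single \<open>indet j\<close> and
  sums; monomials are built up by induction on their total degree.\<close>

lemma dop_induct [case_names scal indet add]:
  assumes scal: "\<And>c. P (scal c)" and indet: "\<And>j L. P L \<Longrightarrow> P (indet j * L)"
    and add: "\<And>L L'. P L \<Longrightarrow> P L' \<Longrightarrow> P (L + L')"
  shows "P (L :: 'n::finite dop)"
proof (induction L rule: poly_mapping_add_induct)
  case zero
  show ?case using scal[of 0] by simp
next
  case (single \<alpha> c)
  show ?case
  proof (induction "\<Sum>j\<in>UNIV. Poly_Mapping.lookup \<alpha> j" arbitrary: \<alpha>)
    case 0
    then have "\<alpha> = 0" by (intro poly_mapping_eqI) simp
    then show ?case using scal[of c] by (simp add: scal_def)
  next
    case (Suc m)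
    then obtain j where j: "Poly_Mapping.lookup \<alpha> j > 0"
      by (metis gr0I nat.distinct(1) sum.neutral)
    define \<beta> where "\<beta> = \<alpha> - Poly_Mapping.single j 1"
    have \<alpha>: "\<alpha> = Poly_Mapping.single j 1 + \<beta>"
      using j by (intro poly_mapping_eqI) (auto simp: \<beta>_def lookup_add lookup_minus lookup_single when_def)
    have "m = (\<Sum>j\<in>UNIV. Poly_Mapping.lookup \<beta> j)"
      using Suc.hyps(2) by (simp add: \<alpha> lookup_add lookup_single sum.distrib when_def)
    from indet[OF Suc.hyps(1)[OF this], of j] show ?case
      by (simp add: indet_def mult_single \<alpha>)
  qed
next
  case (add f g)
  then show ?case by (rule assms(3))
qed

section \<open>Closure of the signal space and linearity of the derivations on it\<close>

lemma PT_fin_poly_add: "f \<in> PT_fin_poly \<Longrightarrow> g \<in> PT_fin_poly \<Longrightarrow> (\<lambda>x. f x + g x) \<in> PT_fin_poly"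
  unfolding PT_fin_poly_def by (rule generated_algebra.add)

lemma PT_fin_poly_mult: "f \<in> PT_fin_poly \<Longrightarrow> g \<in> PT_fin_poly \<Longrightarrow> (\<lambda>x. f x * g x) \<in> PT_fin_poly"
  unfolding PT_fin_poly_def by (rule generated_algebra.mult)

lemma PT_fin_poly_const: "(\<lambda>x. c) \<in> PT_fin_poly"
  unfolding PT_fin_poly_def by (rule generated_algebra.const)

lemma PT_fin_poly_scale: "f \<in> PT_fin_poly \<Longrightarrow> (\<lambda>x. c * f x) \<in> PT_fin_poly"
  by (rule PT_fin_poly_mult[OF PT_fin_poly_const])

lemma PT_fin_poly_sum:
  assumes "\<And>i. i \<in> I \<Longrightarrow> f i \<in> PT_fin_poly"
  shows "(\<lambda>x. \<Sum>i\<in>I. f i x) \<in> PT_fin_poly"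
  using assms
  by (induction I rule: infinite_finite_induct) (auto intro: PT_fin_poly_const PT_fin_poly_add)

lemma PT_fin_poly_coord: "(\<lambda>x. complex_of_real (x $ k)) \<in> PT_fin_poly"
  unfolding PT_fin_poly_def by (rule generated_algebra.gen) blast

lemma PT_fin_poly_character:
  assumes "\<forall>j. a $ j \<in> \<rat>"
  shows "character a \<in> PT_fin_poly"
proof -
  have "character a \<in> PT_fin"
    unfolding PT_fin_def using assms
    by (intro CollectI exI[of _ "{a}"] exI[of _ "\<lambda>_. 1"]) auto
  then show ?thesis unfolding PT_fin_poly_def by (blast intro: generated_algebra.gen)
qed

lemma Dj_add_fin:
  "f \<in> PT_fin_poly \<Longrightarrow> g \<in> PT_fin_poly \<Longrightarrow> Dj j (\<lambda>x. f x + g x) = (\<lambda>x. Dj j f x + Dj j g x)"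
  by (intro Dj_add(2) Dj_PT_fin_poly(1))

lemma Dj_mult_fin:
  "f \<in> PT_fin_poly \<Longrightarrow> g \<in> PT_fin_poly \<Longrightarrow>
    Dj j (\<lambda>x. f x * g x) = (\<lambda>x. f x * Dj j g x + Dj j f x * g x)"
  by (intro Dj_mult(2) Dj_PT_fin_poly(1))

lemma Dj_scale_fin: "f \<in> PT_fin_poly \<Longrightarrow> Dj j (\<lambda>x. c * f x) = (\<lambda>x. c * Dj j f x)"
  using Dj_mult_fin[OF PT_fin_poly_const, of f j c] by (simp add: Dj_const)

lemma Dj_sum_fin:
  assumes "\<And>i. i \<in> I \<Longrightarrow> f i \<in> PT_fin_poly"
  shows "Dj j (\<lambda>x. \<Sum>i\<in>I. f i x) = (\<lambda>x. \<Sum>i\<in>I. Dj j (f i) x)"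
  using assms
proof (induction I rule: infinite_finite_induct)
  case (insert i I)
  then show ?case
    using Dj_add_fin[of "f i" "\<lambda>x. \<Sum>i\<in>I. f i x" j] by (simp add: PT_fin_poly_sum)
qed (simp_all add: Dj_const)

lemma Dj_pow_fin: "f \<in> PT_fin_poly \<Longrightarrow> (Dj j ^^ m) f \<in> PT_fin_poly"
  by (induction m) (simp_all add: Dj_PT_fin_poly(2))

lemma Dj_pow_commute: "f \<in> PT_fin_poly \<Longrightarrow> (Dj k ^^ m) (Dj j f) = Dj j ((Dj k ^^ m) f)"
  by (induction m) (simp_all add: Dj_commute[OF Dj_pow_fin])

lemma coords: "distinct (coords :: 'n::finite list)" "set (coords :: 'n list) = UNIV"
proof -
  have "\<exists>js :: 'n list. distinct js \<and> set js = UNIV"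
    using finite_distinct_list[of "UNIV :: 'n set"] by auto
  then have "distinct (coords :: 'n list) \<and> set (coords :: 'n list) = UNIV"
    unfolding coords_def by (rule someI_ex)
  then show "distinct (coords :: 'n list)" "set (coords :: 'n list) = UNIV" by blast+
qed

lemma foldr_Dj_fin:
  "f \<in> PT_fin_poly \<Longrightarrow> foldr (\<lambda>j. Dj j ^^ m j) js f \<in> PT_fin_poly"
  by (induction js) (simp_all add: Dj_pow_fin)

lemma Dmono_fin: "f \<in> PT_fin_poly \<Longrightarrow> Dmono \<alpha> f \<in> PT_fin_poly"
  unfolding Dmono_def by (rule foldr_Dj_fin)

lemma Dmono_0: "Dmono 0 f = f"
proof -
  have "foldr (\<lambda>j. Dj j ^^ 0) js f = f" for js :: "'a list"
    by (induction js) simp_all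
  then show ?thesis by (simp add: Dmono_def)
qed

text \<open>The extra factor enters at the position of \<open>j\<close> in \<open>coords\<close> and
  is moved to the front by commutation. Distinctness of the list ensures that it enters only
  once.\<close>

lemma Dmono_single_add:
  assumes f: "f \<in> PT_fin_poly"
  shows "Dmono (Poly_Mapping.single j 1 + \<alpha>) f = Dj j (Dmono \<alpha> f)"
proof -
  have comm: "(Dj k ^^ m) (Dj j (foldr (\<lambda>k. Dj k ^^ Poly_Mapping.lookup \<alpha> k) js f)) =
      Dj j ((Dj k ^^ m) (foldr (\<lambda>k. Dj k ^^ Poly_Mapping.lookup \<alpha> k) js f))" for k m js
    by (intro Dj_pow_commute foldr_Dj_fin f)
  have "foldr (\<lambda>k. Dj k ^^ Poly_Mapping.lookup (Poly_Mapping.single j 1 + \<alpha>) k) js f = (if j \<in> set js then Dj j else id)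
      (foldr (\<lambda>k. Dj k ^^ Poly_Mapping.lookup \<alpha> k) js f)" if "distinct js" for js
    using that
  proof (induction js)
    case (Cons k js)
    then show ?case by (auto simp: lookup_add lookup_single comm when_def)
  qed simp
  then show ?thesis unfolding Dmono_def using coords[where 'n='a] by simp
qed

lemma Dmono_add:
  assumes "f \<in> PT_fin_poly" "g \<in> PT_fin_poly"
  shows "Dmono \<alpha> (\<lambda>x. f x + g x) = (\<lambda>x. Dmono \<alpha> f x + Dmono \<alpha> g x)"
proof -
  have pow: "(Dj j ^^ m) (\<lambda>x. f x + g x) = (\<lambda>x. (Dj j ^^ m) f x + (Dj j ^^ m) g x)"
    if "f \<in> PT_fin_poly" "g \<in> PT_fin_poly" for f g j m
    using that by (induction m) (simp_all add: Dj_add_fin Dj_pow_fin)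
  have "foldr (\<lambda>k. Dj k ^^ Poly_Mapping.lookup \<alpha> k) js (\<lambda>x. f x + g x) =
     (\<lambda>x. foldr (\<lambda>k. Dj k ^^ Poly_Mapping.lookup \<alpha> k) js f x +
       foldr (\<lambda>k. Dj k ^^ Poly_Mapping.lookup \<alpha> k) js g x)" for js
    by (induction js) (simp_all add: pow foldr_Dj_fin assms)
  then show ?thesis unfolding Dmono_def by simp
qed

section \<open>The action of the ring of operators on signals\<close>

lemma dop_apply_superset:
  assumes "finite A" "Poly_Mapping.keys L \<subseteq> A"
  shows "dop_apply L f x = (\<Sum>\<alpha>\<in>A. Poly_Mapping.lookup L \<alpha> * Dmono \<alpha> f x)"
  unfolding dop_apply_def using assms by (intro sum.mono_neutral_left) (auto simp: in_keys_iff)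

lemma dop_apply_add: "dop_apply (L + L') f = (\<lambda>x. dop_apply L f x + dop_apply L' f x)"
proof
  fix x
  let ?A = "Poly_Mapping.keys L \<union> Poly_Mapping.keys L'"
  show "dop_apply (L + L') f x = dop_apply L f x + dop_apply L' f x"
    using dop_apply_superset[of ?A "L + L'"] dop_apply_superset[of ?A L] dop_apply_superset[of ?A L']
      keys_add[of L L'] by (simp add: lookup_add ring_distribs sum.distrib)
qed

lemma dop_apply_single: "dop_apply (Poly_Mapping.single \<alpha> c) f = (\<lambda>x. c * Dmono \<alpha> f x)"
  by (cases "c = 0") (simp_all add: dop_apply_def)

lemma dop_apply_scal: "dop_apply (scal c) f = (\<lambda>x. c * f x)"
  by (simp add: scal_def dop_apply_single Dmono_0)

lemma dop_apply_0: "dop_apply 0 f = (\<lambda>x. 0)"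
  by (simp add: dop_apply_def)

lemma dop_apply_1: "dop_apply 1 f = f"
  using dop_apply_scal[of 1 f] by simp

lemma dop_apply_indet_mult:
  assumes f: "f \<in> PT_fin_poly"
  shows "dop_apply (indet j * L) f = Dj j (dop_apply L f) \<and> dop_apply L f \<in> PT_fin_poly"
proof (induction L rule: poly_mapping_add_induct)
  case zero
  show ?case by (simp add: dop_apply_0 Dj_const PT_fin_poly_const)
next
  case (single \<alpha> c)
  show ?case
    by (simp add: indet_def mult_single dop_apply_single Dmono_single_add[OF f, simplified]
      Dj_scale_fin Dmono_fin f PT_fin_poly_scale)
next
  case (add L L')
  then show ?case by (simp add: ring_distribs dop_apply_add Dj_add_fin PT_fin_poly_add)
qed

lemma dop_apply_fin: "f \<in> PT_fin_poly \<Longrightarrow> dop_apply L f \<in> PT_fin_poly"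
  using dop_apply_indet_mult by blast

text \<open>The associativity law of the module of signals. Induction on the left factor peels off
  one \<open>indet j\<close> at a time; a constant on the left needs its own induction on the right
  factor.\<close>

lemma dop_apply_mult:
  assumes f: "f \<in> PT_fin_poly"
  shows "dop_apply (L * L') f = dop_apply L (dop_apply L' f)"
proof (induction L rule: dop_induct)
  case (scal c)
  show ?case
  proof (induction L' rule: poly_mapping_add_induct)
    case zero
    show ?case by (simp add: dop_apply_0 dop_apply_scal)
  next
    case (single \<alpha> d)
    show ?case unfolding scal_def[of c] by (simp add: mult_single dop_apply_single Dmono_0 mult.assoc)
  next
    case (add L L')
    then show ?case by (simp add: ring_distribs dop_apply_add dop_apply_scal)
  qed
next
  case (indet j L)
  then show ?case
    using dop_apply_indet_mult[OF f, of j "L * L'"]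
      dop_apply_indet_mult[OF dop_apply_fin[OF f], of j L L'] by (simp add: mult.assoc)
next
  case (add L1 L2)
  then show ?case by (simp add: ring_distribs dop_apply_add)
qed

lemma dop_apply_add_fun:
  assumes "f \<in> PT_fin_poly" "g \<in> PT_fin_poly"
  shows "dop_apply L (\<lambda>x. f x + g x) = (\<lambda>x. dop_apply L f x + dop_apply L g x)"
  unfolding dop_apply_def Dmono_add[OF assms] by (simp add: ring_distribs sum.distrib)

lemma dop_apply_zero_fun: "dop_apply L (\<lambda>x. 0) = (\<lambda>x. 0)"
  using dop_apply_mult[OF PT_fin_poly_const, of L 0 0] by (simp add: dop_apply_0)

text \<open>Scaling a signal is the action of \<open>scal c\<close>, so commutativity of the ring
  suffices.\<close>

lemma dop_apply_scale_fun:
  assumes "f \<in> PT_fin_poly"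
  shows "dop_apply L (\<lambda>x. c * f x) = (\<lambda>x. c * dop_apply L f x)"
  using dop_apply_mult[OF assms, of L "scal c"] dop_apply_mult[OF assms, of "scal c" L]
  by (simp add: dop_apply_scal mult.commute)

lemma dop_apply_sum_fun:
  assumes "\<And>i. i \<in> I \<Longrightarrow> f i \<in> PT_fin_poly"
  shows "dop_apply L (\<lambda>x. \<Sum>i\<in>I. f i x) = (\<lambda>x. \<Sum>i\<in>I. dop_apply L (f i) x)"
  using assms
proof (induction I rule: infinite_finite_induct)
  case (insert i I)
  then show ?case
    using dop_apply_add_fun[of "f i" "\<lambda>x. \<Sum>i\<in>I. f i x" L] by (simp add: PT_fin_poly_sum)
qed (simp_all add: dop_apply_zero_fun)

section \<open>Evaluation of operators at real points\<close>

definition ev :: "real ^ 'n::finite \<Rightarrow> 'n dop \<Rightarrow> complex" where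
  "ev a L = dop_eval L (\<chi> j. of_real (a $ j))"

text \<open>A character is a joint eigenfunction whose eigenvalue is the value of the operator at
  \<open>a\<close>, and it equals 1 at the origin. The algebraic rules for \<open>ev\<close> are
  thereby inherited from the action.\<close>

lemma ev_eq: "ev a L = dop_apply L (character a) 0"
  by (simp add: dop_apply_character ev_def) (simp add: character_def)

lemma ev_add: "ev a (L + L') = ev a L + ev a L'"
  by (simp add: ev_eq dop_apply_add)

lemma ev_scal: "ev a (scal c) = c"
  by (simp add: ev_eq dop_apply_scal character_def)

lemma ev_mult:
  assumes "\<forall>j. a $ j \<in> \<rat>"
  shows "ev a (L * L') = ev a L * ev a L'"
  using dop_apply_scale_fun[OF PT_fin_poly_character[OF assms], of L "ev a L'"]
  by (simp add: ev_eq[of a "L * L'"] dop_apply_mult[OF PT_fin_poly_character[OF assms]]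
      dop_apply_character[of L'] ev_def[symmetric])
    (simp add: ev_eq mult.commute)

lemma ev_indet: "ev a (indet j) = of_real (a $ j)"
proof -
  have "dop_eval (indet j) z = z $ j" for z :: "complex ^ 'a"
  proof -
    have "(\<Prod>k\<in>UNIV. (z $ k) ^ Poly_Mapping.lookup (Poly_Mapping.single j 1) k) =
        (\<Prod>k\<in>UNIV. if k = j then z $ k else 1)"
      by (intro prod.cong) (auto simp: lookup_single when_def)
    then show ?thesis by (simp add: dop_eval_def indet_def)
  qed
  then show ?thesis by (simp add: ev_def)
qed

section \<open>Polynomial-exponential functions\<close>

text \<open>\<open>polyexp a k g\<close>: every product of \<open>k\<close> of the operators \<open>D\<^sub>j - a\<^sub>j\<close> annihilates \<open>g\<close>, that is,
  \<open>g\<close> is \<open>character a\<close> times a polynomial of degree less than \<open>k\<close>.\<close>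

fun polyexp :: "real ^ 'n::finite \<Rightarrow> nat \<Rightarrow> (real ^ 'n \<Rightarrow> complex) \<Rightarrow> bool" where
  "polyexp a 0 g \<longleftrightarrow> g = (\<lambda>x. 0)"
| "polyexp a (Suc k) g \<longleftrightarrow>
     g \<in> PT_fin_poly \<and> (\<forall>j. polyexp a k (\<lambda>x. Dj j g x + - of_real (a $ j) * g x))"

lemma polyexp_fin: "polyexp a k g \<Longrightarrow> g \<in> PT_fin_poly"
  by (cases k) (simp_all add: PT_fin_poly_const)

lemma polyexp_add: "polyexp a k g \<Longrightarrow> polyexp a k h \<Longrightarrow> polyexp a k (\<lambda>x. g x + h x)"
proof (induction k arbitrary: g h)
  case (Suc k)
  have "polyexp a k (\<lambda>x. Dj j (\<lambda>x. g x + h x) x + - of_real (a $ j) * (g x + h x))" for j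
    using Suc.IH[of "\<lambda>x. Dj j g x + - of_real (a $ j) * g x" "\<lambda>x. Dj j h x + - of_real (a $ j) * h x"] Suc.prems
    by (simp add: Dj_add_fin algebra_simps)
  then show ?case using Suc.prems by (simp add: PT_fin_poly_add)
qed simp

lemma polyexp_scale: "polyexp a k g \<Longrightarrow> polyexp a k (\<lambda>x. c * g x)"
proof (induction k arbitrary: g)
  case (Suc k)
  have "polyexp a k (\<lambda>x. Dj j (\<lambda>x. c * g x) x + - of_real (a $ j) * (c * g x))" for j
    using Suc.IH[of "\<lambda>x. Dj j g x + - of_real (a $ j) * g x"] Suc.prems
    by (simp add: Dj_scale_fin algebra_simps)
  then show ?case using Suc.prems by (simp add: PT_fin_poly_scale)
qed simp

lemma polyexp_zero: "polyexp a k (\<lambda>x. 0)"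
  by (induction k) (simp_all add: PT_fin_poly_const Dj_const)

lemma polyexp_Suc: "polyexp a k g \<Longrightarrow> polyexp a (Suc k) g"
proof (induction k arbitrary: g)
  case 0
  then show ?case by (simp add: PT_fin_poly_const Dj_const)
next
  case (Suc k)
  from Suc.prems have g: "g \<in> PT_fin_poly"
    "\<And>j. polyexp a k (\<lambda>x. Dj j g x + - of_real (a $ j) * g x)"
    by (simp_all only: polyexp.simps)
  show ?case
    unfolding polyexp.simps(2)[of a "Suc k"] using g(1) Suc.IH[OF g(2)] by blast
qed

lemma polyexp_Dj:
  assumes "polyexp a k g"
  shows "polyexp a k (Dj j g)"
proof (cases k)
  case 0
  then show ?thesis using assms by (simp add: Dj_const)
next
  case (Suc m)
  have "polyexp a k (\<lambda>x. Dj j g x + - of_real (a $ j) * g x)"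
    unfolding Suc using assms[unfolded Suc] by (intro polyexp_Suc) simp
  from polyexp_add[OF this polyexp_scale[OF assms, of "of_real (a $ j)"]] show ?thesis
    by simp
qed

text \<open>Leibniz rule: applying \<open>D_j - a_j - b_j\<close> to a product applies
  \<open>D_j - a_j\<close> to the first factor or \<open>D_j - b_j\<close> to the second, which
  lowers \<open>k + l\<close> by one.\<close>

lemma polyexp_mult:
  "polyexp a k g \<Longrightarrow> polyexp b l h \<Longrightarrow> polyexp (a + b) (k + l) (\<lambda>x. g x * h x)"
proof (induction "k + l" arbitrary: k l g h)
  case 0
  then show ?case by simp
next
  case (Suc m)
  show ?case
  proof (cases "k = 0 \<or> l = 0")
    case True
    then have "(\<lambda>x. g x * h x) = (\<lambda>x. 0)" using Suc.prems by auto
    then show ?thesis by (simp only: polyexp_zero)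
  next
    case False
    then obtain k' l' where kl: "k = Suc k'" "l = Suc l'" by (metis not0_implies_Suc)
    note fin = polyexp_fin[OF Suc.prems(1)] polyexp_fin[OF Suc.prems(2)]
    have "polyexp (a + b) m (\<lambda>x. Dj j (\<lambda>x. g x * h x) x + - of_real ((a + b) $ j) * (g x * h x))" for j
    proof -
      have km: "k' + l = m" "k + l' = m" using Suc.hyps(2) kl by simp_all
      have 1: "polyexp (a + b) (k' + l) (\<lambda>x. (Dj j g x + - of_real (a $ j) * g x) * h x)"
        using Suc.hyps(2) Suc.prems kl by (intro Suc.hyps(1)) auto
      have 2: "polyexp (a + b) (k + l') (\<lambda>x. g x * (Dj j h x + - of_real (b $ j) * h x))"
        using Suc.hyps(2) Suc.prems kl by (intro Suc.hyps(1)) auto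
      have "(\<lambda>x. (Dj j g x + - of_real (a $ j) * g x) * h x +
          g x * (Dj j h x + - of_real (b $ j) * h x)) =
          (\<lambda>x. Dj j (\<lambda>x. g x * h x) x + - of_real ((a + b) $ j) * (g x * h x))"
        unfolding Dj_mult_fin[OF fin] by (simp add: algebra_simps)
      with polyexp_add[OF 1[unfolded km(1)] 2[unfolded km(2)]] show ?thesis by (simp only:)
    qed
    then show ?thesis
      unfolding Suc.hyps(2)[symmetric] polyexp.simps using PT_fin_poly_mult[OF fin] by blast
  qed
qed

lemma polyexp_const: "polyexp 0 1 (\<lambda>x. c)"
  by (simp add: PT_fin_poly_const Dj_const)

lemma polyexp_coord: "polyexp 0 2 (\<lambda>x. complex_of_real (x $ k))"
  by (simp add: numeral_2_eq_2 PT_fin_poly_const PT_fin_poly_coord Dj_const Dj_coord)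

lemma polyexp_character:
  assumes "\<forall>j. a $ j \<in> \<rat>"
  shows "polyexp a 1 (\<lambda>x. c * character a x)"
  using PT_fin_poly_scale[OF PT_fin_poly_character[OF assms], of c]
  by (simp add: Dj_character algebra_simps)

text \<open>The operator \<open>L - L(a)\<close> lies in the maximal ideal at \<open>a\<close>, and
  each element of that ideal lowers the order by one.\<close>

lemma polyexp_dop_apply:
  assumes "polyexp a (Suc k) g" and a: "\<forall>j. a $ j \<in> \<rat>"
  shows "polyexp a k (\<lambda>x. dop_apply L g x + - ev a L * g x)"
proof (induction L rule: dop_induct)
  case (scal c)
  show ?case by (simp add: dop_apply_scal ev_scal polyexp_zero)
next
  case (indet j L)
  have g: "g \<in> PT_fin_poly" and gj: "polyexp a k (\<lambda>x. Dj j g x + - of_real (a $ j) * g x)"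
    using assms(1) by simp_all
  note fin = dop_apply_fin[OF g, of L] PT_fin_poly_scale[OF g, of "- ev a L"]
  \<comment> \<open>Splits \<open>D_j L - a_j L(a)\<close> as
    \<open>D_j (L - L(a)) + L(a) (D_j - a_j)\<close>.\<close>
  have "polyexp a k (\<lambda>x. Dj j (\<lambda>x. dop_apply L g x + - ev a L * g x) x +
      ev a L * (Dj j g x + - of_real (a $ j) * g x))"
    by (intro polyexp_add polyexp_Dj indet polyexp_scale gj)
  then show ?case
    unfolding Dj_add_fin[OF fin] Dj_scale_fin[OF g]
    using dop_apply_indet_mult[OF g, of j L] by (simp add: ev_mult[OF a] ev_indet algebra_simps)
next
  case (add L L')
  from polyexp_add[OF this] show ?case
    by (simp add: dop_apply_add ev_add algebra_simps)
qed

text \<open>Frequencies may repeat among the summands, so induction over sums works without a unique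
  decomposition by frequency.\<close>

inductive_set polyexp_sums :: "(real ^ 'n::finite \<Rightarrow> complex) set" where
  base: "\<forall>j. a $ j \<in> \<rat> \<Longrightarrow> polyexp a k g \<Longrightarrow> g \<in> polyexp_sums"
| add: "f \<in> polyexp_sums \<Longrightarrow> g \<in> polyexp_sums \<Longrightarrow> (\<lambda>x. f x + g x) \<in> polyexp_sums"

lemma polyexp_sums_fin: "f \<in> polyexp_sums \<Longrightarrow> f \<in> PT_fin_poly"
  by (induction rule: polyexp_sums.induct) (auto intro: polyexp_fin PT_fin_poly_add)

lemma polyexp_sums_mult:
  assumes "f \<in> polyexp_sums" "g \<in> polyexp_sums"
  shows "(\<lambda>x. f x * g x) \<in> polyexp_sums"
  using assms
proof (induction arbitrary: g rule: polyexp_sums.induct)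
  case (base a k f)
  note f = base.hyps
  from base.prems show ?case
  proof (induction rule: polyexp_sums.induct)
    case (base b l g)
    have "\<forall>j. (a + b) $ j \<in> \<rat>" using f(1) base.hyps(1) by simp
    then show ?case using polyexp_mult[OF f(2) base.hyps(2)] by (rule polyexp_sums.base)
  next
    case (add g h)
    from polyexp_sums.add[OF add.IH] show ?case by (simp add: ring_distribs)
  qed
next
  case (add f h)
  from polyexp_sums.add[OF add.IH(1)[OF add.prems] add.IH(2)[OF add.prems]] show ?case
    by (simp add: ring_distribs)
qed

lemma PT_fin_poly_eq_polyexp_sums: "(PT_fin_poly :: (real ^ 'n::finite \<Rightarrow> complex) set) = polyexp_sums"
proof
  show "polyexp_sums \<subseteq> (PT_fin_poly :: (real ^ 'n \<Rightarrow> complex) set)" using polyexp_sums_fin by blast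
  show "PT_fin_poly \<subseteq> (polyexp_sums :: (real ^ 'n \<Rightarrow> complex) set)"
  proof
    fix f :: "real ^ 'n \<Rightarrow> complex"
    assume "f \<in> PT_fin_poly"
    then show "f \<in> polyexp_sums"
      unfolding PT_fin_poly_def
    proof (induction rule: generated_algebra.induct)
      case (gen f)
      then consider "f \<in> PT_fin" | k where "f = (\<lambda>x. complex_of_real (x $ k))" by auto
      then show ?case
      proof cases
        case 1
        then obtain A c where A: "finite A" "A \<subseteq> {a. \<forall>j. a $ j \<in> \<rat>}"
          and f: "f = (\<lambda>x. \<Sum>a\<in>A. c a * character a x)"
          unfolding PT_fin_def by blast
        show ?thesis
          unfolding f using A
        proof (induction A rule: finite_induct)
          case empty
          show ?case using polyexp_sums.base[OF _ polyexp_zero, of 0] by simp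
        next
          case (insert a A)
          then have "(\<lambda>x. c a * character a x) \<in> polyexp_sums"
            by (intro polyexp_sums.base[OF _ polyexp_character]) auto
          from polyexp_sums.add[OF this, of "\<lambda>x. \<Sum>a\<in>A. c a * character a x"] insert
          show ?case by simp
        qed
      next
        case 2
        show ?thesis unfolding 2 by (rule polyexp_sums.base[OF _ polyexp_coord]) simp
      qed
    next
      case (const c)
      show ?case by (rule polyexp_sums.base[OF _ polyexp_const]) simp
    qed (auto intro: polyexp_sums.add polyexp_sums_mult)
  qed
qed

text \<open>If \<open>s w = 0\<close> and \<open>s(a) = 1\<close>, then \<open>1 - s\<close> fixes \<open>w\<close> and is nilpotent on the
  polynomial-exponential functions with frequency \<open>a\<close>; the product of such powers over the
  frequencies of \<open>w\<close> both fixes and annihilates \<open>w\<close>.\<close>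

lemma zero_if_annihilator_avoids_rational_points:
  assumes w: "w \<in> PT_fin_poly"
    and ann: "\<And>a. \<forall>j. a $ j \<in> \<rat> \<Longrightarrow> \<exists>s. ev a s \<noteq> 0 \<and> dop_apply s w = (\<lambda>x. 0)"
  shows "w = (\<lambda>x. 0)"
proof -
  have "\<exists>u. dop_apply u w = w \<and> dop_apply u f = (\<lambda>x. 0)" if "f \<in> polyexp_sums" for f
    using that
  proof (induction rule: polyexp_sums.induct)
    case (base a k g)
    obtain s where s: "ev a s \<noteq> 0" "dop_apply s w = (\<lambda>x. 0)" using ann base(1) by blast
    \<comment> \<open>Normalising \<open>s\<close> to the value 1 at \<open>a\<close> makes
      \<open>u\<close> vanish there while it still fixes \<open>w\<close>.\<close>
    define u where "u = 1 + scal (- 1 / ev a s) * s"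
    have uw: "dop_apply u w = w"
      by (simp add: u_def dop_apply_add dop_apply_1 dop_apply_mult[OF w] dop_apply_scal s(2))
    have eu: "ev a u = 0"
      using s(1) ev_scal[of a 1] by (simp add: u_def ev_add ev_mult[OF base(1)] ev_scal)
    have "dop_apply (u ^ k) w = w"
      by (induction k) (simp_all add: dop_apply_1 dop_apply_mult[OF w] uw)
    moreover have "dop_apply (u ^ k) g = (\<lambda>x. 0)"
      using base(2)
    proof (induction k arbitrary: g)
      case 0
      then show ?case by (simp add: dop_apply_1)
    next
      case (Suc k)
      have "polyexp a k (dop_apply u g)"
        using polyexp_dop_apply[OF Suc.prems base(1), of u] by (simp add: eu)
      from Suc.IH[OF this] show ?case
        using dop_apply_mult[OF polyexp_fin[OF Suc.prems], of "u ^ k" u]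
        by (simp add: mult.commute)
    qed
    ultimately show ?case by blast
  next
    case (add f g)
    then obtain u v where u: "dop_apply u w = w" "dop_apply u f = (\<lambda>x. 0)"
      and v: "dop_apply v w = w" "dop_apply v g = (\<lambda>x. 0)" by blast
    note f = polyexp_sums_fin[OF add.hyps(1)] and g = polyexp_sums_fin[OF add.hyps(2)]
    have "dop_apply (u * v) f = (\<lambda>x. 0)"
      using dop_apply_mult[OF f, of v u] by (simp add: mult.commute u(2) dop_apply_zero_fun)
    then have "dop_apply (u * v) (\<lambda>x. f x + g x) = (\<lambda>x. 0)"
      by (simp add: dop_apply_add_fun[OF f g] dop_apply_mult[OF g] v(2) dop_apply_zero_fun)
    moreover have "dop_apply (u * v) w = w" by (simp add: dop_apply_mult[OF w] u v)
    ultimately show ?case by blast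
  qed
  from this[of w] w show ?thesis unfolding PT_fin_poly_eq_polyexp_sums by auto
qed

section \<open>Signals that separate a primary submodule from an element outside it\<close>

text \<open>Linear algebra over the complex numbers, acting through \<open>scal\<close>: a basis of
  \<open>N\<close> stays independent when \<open>v\<close> is added, and a functional may be
  prescribed on the enlarged set.\<close>

lemma separating_functional:
  fixes N :: "('n dop ^ 'q) set"
  assumes N: "is_submodule N" and v: "v \<notin> N"
  shows "\<exists>\<phi> :: 'n dop ^ 'q \<Rightarrow> complex. (\<forall>x y. \<phi> (x + y) = \<phi> x + \<phi> y) \<and>
    (\<forall>c x. \<phi> (scal c *s x) = c * \<phi> x) \<and> (\<forall>x\<in>N. \<phi> x = 0) \<and> \<phi> v = 1"
proof -
  interpret vector_space_pair "\<lambda>c (v :: 'n dop ^ 'q). scal c *s v" "(*) :: complex \<Rightarrow> complex \<Rightarrow> complex"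
    by unfold_locales
      (auto simp: vec_eq_iff scal_add scal_mult algebra_simps)
  have "vs1.subspace N"
    using N by (intro vs1.subspaceI) (auto intro: submodule_0 submodule_add submodule_scale)
  obtain B where B: "B \<subseteq> N" "vs1.independent B" "N \<subseteq> vs1.span B"
    using vs1.maximal_independent_subset[of N] by blast
  have "vs1.span B \<subseteq> N"
    using B(1) \<open>vs1.subspace N\<close> by (rule vs1.span_minimal)
  with v have "v \<notin> vs1.span B" by blast
  with B(2) have ind: "vs1.independent (insert v B)" by (simp add: vs1.independent_insert)
  define \<phi> where "\<phi> = construct (insert v B) (\<lambda>b. if b = v then 1 else 0)"
  have lin: "Vector_Spaces.linear (\<lambda>c v. scal c *s v) (*) \<phi>"
    unfolding \<phi>_def by (rule linear_construct[OF ind])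
  have "\<phi> b = 0" if "b \<in> B" for b
    using construct_basis[OF ind, of b] that v B(1) by (auto simp: \<phi>_def)
  then have "\<phi> x = 0" if "x \<in> N" for x
    using linear_eq_0_on_span[OF lin] that B(3) by blast
  moreover have "\<phi> v = 1"
    using construct_basis[OF ind, of v] by (simp add: \<phi>_def)
  ultimately show ?thesis
    using linear_add[OF lin] linear_scale[OF lin] by blast
qed

text \<open>The ascending chain condition takes the place of Zorn's lemma. In the quotient by
  \<open>N'\<close> every nonzero submodule contains the class of \<open>v\<close>.\<close>

lemma maximal_submodule_avoiding:
  fixes N :: "('n::finite dop ^ 'q::finite) set"
  assumes "is_submodule N" "v \<notin> N"
  obtains N' where "is_submodule N'" "N \<subseteq> N'" "v \<notin> N'"
    "\<And>J. is_submodule J \<Longrightarrow> N' \<subset> J \<Longrightarrow> v \<in> J"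
proof -
  define S where "S = {J. is_submodule J \<and> N \<subseteq> J \<and> v \<notin> J}"
  have "N \<in> S" using assms by (simp add: S_def)
  then obtain N' where N': "N' \<in> S"
    "\<And>J. (J, N') \<in> {(J, I). is_submodule I \<and> is_submodule J \<and> I \<subset> J} \<Longrightarrow> J \<notin> S"
    by (rule wfE_min[OF submodule_acc]) (rule that)
  show ?thesis
  proof (rule that[of N'])
    show "is_submodule N'" "N \<subseteq> N'" "v \<notin> N'" using N'(1) by (simp_all add: S_def)
    show "v \<in> J" if "is_submodule J" "N' \<subset> J" for J
      using N'(1) N'(2)[of J] that by (auto simp: S_def)
  qed
qed

text \<open>Fitting's argument for \<open>y\<close> acting on the quotient. The kernels of its
  powers stabilise at some \<open>K\<close>. If \<open>v = n + y ^ K *s d\<close> with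
  \<open>n\<close> in \<open>N\<close>, then \<open>y ^ Suc K *s d\<close> is in \<open>N\<close>,
  hence so are \<open>y ^ K *s d\<close> and \<open>v\<close>. Thus adding the image of
  \<open>y ^ K\<close> to \<open>N\<close> still avoids \<open>v\<close>, and maximality puts that
  image into \<open>N\<close>.\<close>

lemma maximal_avoiding_nilpotent:
  fixes N :: "('n::finite dop ^ 'q::finite) set"
  assumes N: "is_submodule N" "v \<notin> N"
    and max: "\<And>J. is_submodule J \<Longrightarrow> N \<subset> J \<Longrightarrow> v \<in> J"
    and y: "y *s v \<in> N"
  shows "\<exists>K. \<forall>w. y ^ K *s w \<in> N"
proof -
  define C where "C k = {w. y ^ k *s w \<in> N}" for k
  have "is_submodule (C k)" for k
  proof (rule submoduleI)
    show "0 \<in> C k" using submodule_0[OF N(1)] by (simp add: C_def)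
    show "w + w' \<in> C k" if "w \<in> C k" "w' \<in> C k" for w w'
      using submodule_add[OF N(1)] that by (simp add: C_def vector_add_ldistrib)
    show "c *s w \<in> C k" if "w \<in> C k" for c w
      using submodule_scale_swap[OF N(1)] that by (simp add: C_def)
  qed
  moreover have "C k \<subseteq> C (Suc k)" for k
  proof
    fix w
    assume "w \<in> C k"
    then show "w \<in> C (Suc k)"
      using submodule_scale[OF N(1), of "y ^ k *s w" y] by (simp add: C_def vector_smult_assoc)
  qed
  ultimately obtain K where K: "C (Suc K) = C K"
    using submodule_chain_stabilizes[of C] by blast
  define J where "J = {n + y ^ K *s d | n d. n \<in> N}"
  have JI: "n + y ^ K *s d \<in> J" if "n \<in> N" for n d using that by (auto simp: J_def)
  have "is_submodule J"
  proof (rule submoduleI)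
    show "0 \<in> J" using JI[OF submodule_0[OF N(1)], of 0] by simp
    show "x + x' \<in> J" if xx: "x \<in> J" "x' \<in> J" for x x'
    proof -
      obtain n d n' d' where "x = n + y ^ K *s d" "n \<in> N" "x' = n' + y ^ K *s d'" "n' \<in> N"
        using xx by (auto simp: J_def)
      then show ?thesis
        using JI[OF submodule_add[OF N(1), of n n'], of "d + d'"]
        by (simp add: vector_add_ldistrib algebra_simps)
    qed
    show "c *s x \<in> J" if x: "x \<in> J" for c x
    proof -
      obtain n d where "x = n + y ^ K *s d" "n \<in> N" using x by (auto simp: J_def)
      then show ?thesis
        using JI[OF submodule_scale[OF N(1), of n c], of "c *s d"]
        by (simp add: vector_add_ldistrib vector_smult_assoc mult.commute)
    qed
  qed
  moreover have "N \<subseteq> J" using JI[of _ 0] by auto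
  moreover have "v \<notin> J"
  proof
    assume "v \<in> J"
    then obtain n d where nd: "v = n + y ^ K *s d" "n \<in> N" by (auto simp: J_def)
    have "y *s v - y *s n \<in> N" by (intro submodule_diff[OF N(1)] y submodule_scale[OF N(1)] nd(2))
    then have "d \<in> C (Suc K)" by (simp add: nd(1) C_def vector_add_ldistrib vector_smult_assoc)
    then have "v \<in> N" using submodule_add[OF N(1) nd(2)] by (simp add: K nd(1)) (simp add: C_def)
    with N(2) show False ..
  qed
  ultimately have "J = N" using max[of J] by blast
  then show ?thesis using JI[OF submodule_0[OF N(1)]] by auto
qed

lemma ideal_power_ge:
  fixes I :: "'a::comm_ring_1 set"
  assumes "is_ideal I" "b ^ n \<in> I" "n \<le> m"
  shows "b ^ m \<in> I"
  using ideal_scale[OF assms(1,2), of "b ^ (m - n)"] assms(3) by (simp flip: power_add)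

text \<open>In the binomial expansion with exponent \<open>K i + n\<close>, each term contains the
  \<open>K i\<close>-th power of the new summand or the \<open>n\<close>-th power of the rest. The
  successor covers the empty sum, where \<open>0 ^ 0 = 1\<close> need not lie in
  \<open>I\<close>.\<close>

lemma ideal_power_sum:
  fixes I :: "'a::comm_ring_1 set"
  assumes I: "is_ideal I" and "finite A" and K: "\<And>j. j \<in> A \<Longrightarrow> y j ^ K j \<in> I"
  shows "(\<Sum>j\<in>A. c j * y j) ^ Suc (\<Sum>j\<in>A. K j) \<in> I"
  using assms(2,3)
proof (induction A rule: finite_induct)
  case empty
  show ?case using ideal_0[OF I] by simp
next
  case (insert i A)
  define b where "b = (\<Sum>j\<in>A. c j * y j)"
  define n where "n = Suc (\<Sum>j\<in>A. K j)"
  have b: "b ^ n \<in> I" unfolding b_def n_def using insert by simp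
  have a: "(c i * y i) ^ K i \<in> I"
    using ideal_scale[OF I insert.prems[of i], of "c i ^ K i"] by (simp add: power_mult_distrib)
  have "of_nat ((K i + n) choose k) * (c i * y i) ^ k * b ^ (K i + n - k) \<in> I" for k
  proof (cases "K i \<le> k")
    case True
    from ideal_scale[OF I ideal_power_ge[OF I a True],
        of "of_nat ((K i + n) choose k) * b ^ (K i + n - k)"]
    show ?thesis by (simp add: mult_ac)
  next
    case False
    then have "n \<le> K i + n - k" by simp
    from ideal_scale[OF I ideal_power_ge[OF I b this], of "of_nat ((K i + n) choose k) * (c i * y i) ^ k"]
    show ?thesis by (simp add: mult_ac)
  qed
  then have "(c i * y i + b) ^ (K i + n) \<in> I" (is "?p \<in> I")
    unfolding binomial_ring by (intro ideal_sum[OF I]) auto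
  also have "?p = (\<Sum>j\<in>insert i A. c j * y j) ^ Suc (\<Sum>j\<in>insert i A. K j)"
    using insert.hyps by (simp add: b_def n_def)
  finally show ?case .
qed

lemma ev_diff: "ev a (L - L') = ev a L - ev a L'"
  using ev_add[of a "L - L'" L'] by simp

text \<open>\<open>shift a x\<close> is the symbol \<open>\<i>\<langle>x, D - a\<rangle>\<close>, so that \<open>exp (\<i>\<langle>x, D\<rangle>)\<close> is
  \<open>character a x\<close> times the exponential of \<open>shift a x\<close>.  A functional \<open>\<phi>\<close> on polynomials that vanishes
  on high powers turns this into the signal \<open>x \<mapsto> \<phi> (exp (\<i>\<langle>x, D\<rangle>))\<close>, on which \<open>D\<^sub>j\<close> acts
  as multiplication by \<open>indet j\<close> inside \<open>\<phi>\<close>.\<close>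

definition shift :: "real ^ 'n::finite \<Rightarrow> real ^ 'n \<Rightarrow> 'n dop" where
  "shift a x = (\<Sum>j\<in>UNIV. scal (\<i> * of_real (x $ j)) * (indet j - scal (of_real (a $ j))))"

locale nilpotent_functional =
  fixes \<phi> :: "'n::finite dop \<Rightarrow> complex" and a :: "real ^ 'n" and K :: nat
  assumes \<phi>_add: "\<phi> (L + L') = \<phi> L + \<phi> L'"
    and \<phi>_scal: "\<phi> (scal c * L) = c * \<phi> L"
    and \<phi>_nil: "K \<le> k \<Longrightarrow> \<phi> (L * shift a x ^ k) = 0"
    and rational: "\<forall>j. a $ j \<in> \<rat>"
begin

lemma \<phi>_0: "\<phi> 0 = 0"
  using \<phi>_scal[of 0 0] by simp

lemma \<phi>_sum: "\<phi> (\<Sum>i\<in>I. L i) = (\<Sum>i\<in>I. \<phi> (L i))"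
  by (induction I rule: infinite_finite_induct) (simp_all add: \<phi>_0 \<phi>_add)

text \<open>Peeling off one factor exposes the dependence on \<open>x\<close> through the
  coordinates and moves the rest into \<open>L\<close>; this recursion drives the next two
  lemmas.\<close>

lemma \<phi>_shift_Suc:
  "\<phi> (L * shift a x ^ Suc k) =
    (\<Sum>j\<in>UNIV. \<i> * of_real (x $ j) * \<phi> (L * (indet j - scal (of_real (a $ j))) * shift a x ^ k))"
proof -
  have "L * shift a x ^ Suc k = (\<Sum>j\<in>UNIV. scal (\<i> * of_real (x $ j)) *
      (L * (indet j - scal (of_real (a $ j))) * shift a x ^ k))"
    unfolding power_Suc by (subst (1) shift_def) (simp add: sum_distrib_left sum_distrib_right mult_ac)
  then show ?thesis by (simp only: \<phi>_sum \<phi>_scal)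
qed

lemma \<phi>_shift_fin: "(\<lambda>x. \<phi> (L * shift a x ^ k)) \<in> PT_fin_poly"
proof (induction k arbitrary: L)
  case 0
  show ?case by (simp add: PT_fin_poly_const)
next
  case (Suc k)
  show ?case
    unfolding \<phi>_shift_Suc
    by (intro PT_fin_poly_sum PT_fin_poly_mult PT_fin_poly_const PT_fin_poly_coord Suc)
qed

text \<open>The power rule under \<open>\<phi>\<close>, where the factor \<open>1 / \<i>\<close> of
  \<open>Dj\<close> cancels the \<open>\<i>\<close> in \<open>shift\<close>. For
  \<open>k = 0\<close> the truncated \<open>k - 1\<close> is harmless because of the factor
  \<open>of_nat k\<close>.\<close>

lemma Dj_\<phi>_shift:
  "Dj j (\<lambda>x. \<phi> (L * shift a x ^ k)) =
    (\<lambda>x. of_nat k * \<phi> (L * (indet j - scal (of_real (a $ j))) * shift a x ^ (k - 1)))"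
proof (induction k arbitrary: L)
  case 0
  show ?case by (simp add: Dj_const)
next
  case (Suc k)
  define y where "y m = indet m - scal (of_real (a $ m))" for m
  define h where "h L k = (\<lambda>x. \<phi> (L * shift a x ^ k))" for L k
  have h: "h L k \<in> PT_fin_poly" for L k unfolding h_def by (rule \<phi>_shift_fin)
  have h_Suc: "h L (Suc k) = (\<lambda>x. \<Sum>m\<in>UNIV. \<i> * of_real (x $ m) * h (L * y m) k x)" for L k
    unfolding h_def y_def \<phi>_shift_Suc ..
  have coord: "Dj j (\<lambda>x. \<i> * complex_of_real (x $ m)) = (\<lambda>x. if m = j then 1 else 0)" for m
    using Dj_scale_fin[OF PT_fin_poly_coord, of j \<i> m] by (auto simp: Dj_coord)
  have IH: "Dj j (h L k) = (\<lambda>x. of_nat k * h (L * y j) (k - 1) x)" for L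
    unfolding h_def y_def by (rule Suc.IH)
  have "Dj j (h L (Suc k)) x = of_nat (Suc k) * h (L * y j) k x" for x
  proof -
    have "Dj j (h L (Suc k)) x =
        (\<Sum>m\<in>UNIV. Dj j (\<lambda>x. (\<i> * of_real (x $ m)) * h (L * y m) k x) x)"
      unfolding h_Suc by (subst Dj_sum_fin) (auto intro!: PT_fin_poly_mult PT_fin_poly_const PT_fin_poly_coord h)
    also have "\<dots> = (\<Sum>m\<in>UNIV. (\<i> * of_real (x $ m)) * Dj j (h (L * y m) k) x +
        (if m = j then 1 else 0) * h (L * y m) k x)"
      by (subst Dj_mult_fin) (auto simp: coord intro!: PT_fin_poly_scale PT_fin_poly_coord h)
    also have "\<dots> = (\<Sum>m\<in>UNIV. \<i> * of_real (x $ m) * Dj j (h (L * y m) k) x) +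
        (\<Sum>m\<in>UNIV. if m = j then h (L * y m) k x else 0)"
      by (simp only: sum.distrib if_distrib[of "\<lambda>z. z * _"] mult_1_left mult_zero_left)
    also have "(\<Sum>m\<in>UNIV. if m = j then h (L * y m) k x else 0) = h (L * y j) k x"
      by simp
    \<comment> \<open>Read backwards, the recursion \<open>h_Suc\<close> reassembles the
      differentiated terms into \<open>k\<close> copies of the function that the product rule
      contributes once more.\<close>
    also have "(\<Sum>m\<in>UNIV. \<i> * of_real (x $ m) * Dj j (h (L * y m) k) x) = of_nat k * h (L * y j) k x"
    proof (cases k)
      case 0
      then show ?thesis unfolding IH by simp
    next
      case (Suc l)
      then show ?thesis
        unfolding IH by (simp add: h_Suc[of _ l] sum_distrib_left mult_ac)
    qed
    finally show ?thesis by (simp add: algebra_simps)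
  qed
  then show ?case unfolding h_def y_def by (simp add: fun_eq_iff)
qed

text \<open>The exponential series may stop at \<open>K\<close> because \<open>\<phi>\<close> kills
  the higher powers. Carrying \<open>L\<close> along turns the action of operators into
  multiplication.\<close>

definition signal :: "'n dop \<Rightarrow> real ^ 'n \<Rightarrow> complex" where
  "signal L = (\<lambda>x. character a x * (\<Sum>k\<le>K. 1 / fact k * \<phi> (L * shift a x ^ k)))"

lemma signal_fin: "signal L \<in> PT_fin_poly"
  unfolding signal_def
  by (intro PT_fin_poly_mult PT_fin_poly_character rational PT_fin_poly_sum PT_fin_poly_const \<phi>_shift_fin)

lemma signal_add: "signal (L + L') = (\<lambda>x. signal L x + signal L' x)"
  by (simp add: signal_def ring_distribs \<phi>_add sum.distrib)

lemma signal_scal: "signal (scal c * L) = (\<lambda>x. c * signal L x)"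
  by (simp add: signal_def mult.assoc \<phi>_scal) (simp add: sum_distrib_left mult_ac)

lemma Dj_signal: "Dj j (signal L) = signal (indet j * L)"
proof
  fix x
  define y where "y = indet j - scal (of_real (a $ j))"
  define P where "P = (\<lambda>x. \<Sum>k\<le>K. 1 / fact k * \<phi> (L * shift a x ^ k))"
  have P: "P \<in> PT_fin_poly"
    unfolding P_def by (intro PT_fin_poly_sum PT_fin_poly_scale \<phi>_shift_fin)
  have "Dj j P x = (\<Sum>k\<le>K. 1 / fact k * (of_nat k * \<phi> (L * y * shift a x ^ (k - 1))))"
    unfolding P_def y_def
    by (simp only: Dj_sum_fin Dj_scale_fin PT_fin_poly_scale \<phi>_shift_fin Dj_\<phi>_shift)
  \<comment> \<open>The term \<open>k = 0\<close> vanishes, and the index moves down by one.\<close>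
  also have "\<dots> = (\<Sum>k<K. 1 / fact (Suc k) * (of_nat (Suc k) * \<phi> (L * y * shift a x ^ k)))"
  proof (cases K)
    case (Suc m)
    show ?thesis
      unfolding Suc sum.atMost_Suc_shift lessThan_Suc_atMost by (simp del: fact_Suc of_nat_Suc)
  qed simp
  also have "\<dots> = (\<Sum>k<K. 1 / fact k * \<phi> (L * y * shift a x ^ k))"
    by (intro sum.cong) (simp_all add: field_simps del: of_nat_Suc)
  \<comment> \<open>The term \<open>k = K\<close> is zero by \<open>\<phi>_nil\<close>, so the
    original range is restored.\<close>
  also have "\<dots> = (\<Sum>k\<le>K. 1 / fact k * \<phi> (L * y * shift a x ^ k))"
    unfolding lessThan_Suc_atMost[symmetric] by (simp add: \<phi>_nil)
  finally have DP: "character a x * Dj j P x = signal (L * y) x"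
    by (simp add: signal_def)
  have "Dj j (signal L) x = character a x * Dj j P x + Dj j (character a) x * P x"
    using fun_cong[OF Dj_mult_fin[OF PT_fin_poly_character[OF rational] P], of j x]
    by (simp add: signal_def P_def)
  also have "Dj j (character a) x * P x = of_real (a $ j) * signal L x"
    using fun_cong[OF Dj_character(2)[of j 1 a], of x] by (simp add: signal_def P_def)
  also have "character a x * Dj j P x + of_real (a $ j) * signal L x =
      signal (L * y + scal (of_real (a $ j)) * L) x"
    by (simp only: DP signal_add signal_scal)
  also have "L * y + scal (of_real (a $ j)) * L = indet j * L"
    by (simp add: y_def algebra_simps)
  finally show "Dj j (signal L) x = signal (indet j * L) x" .
qed

lemma dop_apply_signal: "dop_apply P (signal L) = signal (P * L)"
proof (induction P rule: dop_induct)
  case (scal c)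
  show ?case by (simp add: dop_apply_scal signal_scal)
next
  case (indet j P)
  then show ?case
    using dop_apply_indet_mult[OF signal_fin, of j P] by (simp add: Dj_signal mult.assoc)
next
  case (add P P')
  then show ?case by (simp add: dop_apply_add ring_distribs signal_add)
qed

end

text \<open>Krull's intersection theorem in disguise: \<open>v\<close> stays outside \<open>N\<close> after adding the multiples of \<open>v\<close> by the
  maximal ideal at \<open>a\<close>, and a submodule maximal with this property contains a power of that ideal
  times the whole module.\<close>

lemma primary_separating_signal:
  fixes N :: "('n::finite dop ^ 'q::finite) set"
  assumes prim: "is_primary P N" and a: "\<forall>j. a $ j \<in> \<rat>"
    and P: "\<And>s. s \<in> P \<Longrightarrow> ev a s = 0" and v: "v \<notin> N"
  shows "\<exists>f. f \<in> behavior PT_fin_poly N \<and> (\<Sum>j\<in>UNIV. dop_apply (v $ j) (f $ j) 0) = 1"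
proof -
  have N: "is_submodule N" using prim by (simp add: is_primary_def)
  define N0 where "N0 = {n + s *s v | n s. n \<in> N \<and> ev a s = 0}"
  have N0I: "n + s *s v \<in> N0" if "n \<in> N" "ev a s = 0" for n s using that by (auto simp: N0_def)
  have ev0: "ev a 0 = 0" using ev_scal[of a 0] by simp
  have "is_submodule N0"
  proof (rule submoduleI)
    show "0 \<in> N0" using N0I[OF submodule_0[OF N] ev0] by simp
    show "x + x' \<in> N0" if xx: "x \<in> N0" "x' \<in> N0" for x x'
    proof -
      obtain n s n' s' where "x = n + s *s v" "n \<in> N" "ev a s = 0" "x' = n' + s' *s v" "n' \<in> N" "ev a s' = 0"
        using xx by (auto simp: N0_def)
      then show ?thesis
        using N0I[OF submodule_add[OF N, of n n'], of "s + s'"]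
        by (simp add: vector_sadd_rdistrib ev_add algebra_simps)
    qed
    show "c *s x \<in> N0" if x: "x \<in> N0" for c x
    proof -
      obtain n s where "x = n + s *s v" "n \<in> N" "ev a s = 0" using x by (auto simp: N0_def)
      then show ?thesis
        using N0I[OF submodule_scale[OF N, of n c], of "c * s"]
        by (simp add: vector_add_ldistrib vector_smult_assoc ev_mult[OF a])
    qed
  qed
  moreover have "v \<notin> N0"
  proof
    assume "v \<in> N0"
    then obtain n s where ns: "v = n + s *s v" "n \<in> N" "ev a s = 0" by (auto simp: N0_def)
    \<comment> \<open>As in Nakayama's lemma: \<open>1 - s\<close> carries \<open>v\<close> into
      \<open>N\<close>, so it lies in \<open>P\<close> and vanishes at \<open>a\<close>, although
      its value there is 1.\<close>
    have "(1 - s) *s v = v - s *s v" by (simp add: vec_eq_iff algebra_simps)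
    also have "\<dots> = n" using ns(1) by (metis add_diff_cancel_right')
    finally have "(1 - s) *s v \<in> N" using ns(2) by simp
    then have "1 - s \<in> P" using primary_annihilator_subset[OF prim v] by blast
    from P[OF this] show False using ns(3) ev_scal[of a 1] by (simp add: ev_diff)
  qed
  ultimately obtain N' where N': "is_submodule N'" "N0 \<subseteq> N'" "v \<notin> N'"
    "\<And>J. is_submodule J \<Longrightarrow> N' \<subset> J \<Longrightarrow> v \<in> J"
    using maximal_submodule_avoiding by blast
  have "N \<subseteq> N0" using N0I[OF _ ev0] by auto
  define y where "y j = indet j - scal (complex_of_real (a $ j))" for j
  have "y j *s v \<in> N'" for j
    using N0I[OF submodule_0[OF N], of "y j"] N'(2)
    by (auto simp: y_def ev_diff ev_indet ev_scal)
  then have "\<forall>j. \<exists>K. \<forall>w. y j ^ K *s w \<in> N'"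
    using maximal_avoiding_nilpotent[OF N'(1,3,4)] by blast
  then obtain k where k: "\<And>j w. y j ^ k j *s w \<in> N'" by metis
  \<comment> \<open>The annihilator of the whole quotient by \<open>N'\<close>; it contains a power
    of each \<open>y j\<close>.\<close>
  define I where "I = (\<Inter>w. {s. s *s w \<in> N'})"
  have I: "is_ideal I"
    unfolding I_def by (intro module.subspace_Int[OF module_self] ideal_annihilator N'(1))
  \<comment> \<open>The exponent from \<open>ideal_power_sum\<close> does not depend on the
    coefficients, so one \<open>K\<close> serves all \<open>x\<close>.\<close>
  define K where "K = Suc (\<Sum>j\<in>UNIV. k j)"
  have "shift a x ^ K \<in> I" for x
    unfolding shift_def K_def y_def[symmetric]
    by (rule ideal_power_sum[OF I]) (use k in \<open>auto simp: I_def\<close>)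
  then have nil: "(shift a x ^ m) *s w \<in> N'" if "K \<le> m" for x m w
    using ideal_power_ge[OF I _ that] by (auto simp: I_def)
  obtain \<phi> :: "'n dop ^ 'q \<Rightarrow> complex" where \<phi>: "\<And>x y. \<phi> (x + y) = \<phi> x + \<phi> y"
    "\<And>c x. \<phi> (scal c *s x) = c * \<phi> x" "\<And>x. x \<in> N' \<Longrightarrow> \<phi> x = 0" "\<phi> v = 1"
    using separating_functional[OF N'(1,3)] by blast
  have axis_add: "axis l (L + L') = axis l L + axis l L'" for l :: 'q and L L' :: "'n dop"
    by (simp add: vec_eq_iff axis_def)
  have axis_mult: "axis l (c * L) = c *s axis l L" for l :: 'q and c L :: "'n dop"
    by (simp add: vec_eq_iff axis_def)
  interpret nf: nilpotent_functional "\<lambda>L. \<phi> (axis l L)" a K for l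
  proof
    show "\<phi> (axis l (L * shift a x ^ m)) = 0" if "K \<le> m" for m L x
      using \<phi>(3)[OF nil[OF that, of x "axis l L"]] by (simp only: axis_mult mult.commute[of L])
  qed (simp_all add: axis_add axis_mult \<phi>(1,2) a)
  define f where "f = (\<chi> l. nf.signal l 1)"
  have \<phi>0: "\<phi> 0 = 0" using \<phi>(2)[of 0 0] by simp
  have \<phi>_sum: "\<phi> (\<Sum>i\<in>A. w i) = (\<Sum>i\<in>A. \<phi> (w i))" for A :: "'q set" and w
    by (induction A rule: infinite_finite_induct) (simp_all add: \<phi>(1) \<phi>0)
  \<comment> \<open>Summed over the components, the action of \<open>r\<close> on \<open>f\<close>
    is \<open>\<phi>\<close> evaluated on the exponential series times \<open>r\<close>. It vanishes
    for \<open>r\<close> in \<open>N\<close>, and for \<open>r = v\<close> at the origin only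
    \<open>\<phi> v = 1\<close> remains.\<close>
  have apply_f: "(\<Sum>l\<in>UNIV. dop_apply (r $ l) (f $ l) x) =
      character a x * (\<Sum>m\<le>K. 1 / fact m * \<phi> ((shift a x ^ m) *s r))" for r x
  proof -
    have expand: "(\<Sum>l\<in>UNIV. axis l (r $ l * shift a x ^ m)) = (shift a x ^ m) *s r" for m
      by (simp add: vec_eq_iff axis_def mult.commute)
    have "(\<Sum>l\<in>UNIV. dop_apply (r $ l) (f $ l) x) = (\<Sum>l\<in>UNIV. character a x *
        (\<Sum>m\<le>K. 1 / fact m * \<phi> (axis l (r $ l * shift a x ^ m))))"
      unfolding f_def vec_lambda_beta nf.dop_apply_signal mult_1_right by (simp add: nf.signal_def)
    also have "\<dots> = character a x * (\<Sum>m\<le>K. 1 / fact m *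
        (\<Sum>l\<in>UNIV. \<phi> (axis l (r $ l * shift a x ^ m))))"
      unfolding sum_distrib_left by (rule sum.swap)
    finally show ?thesis by (simp only: \<phi>_sum[symmetric] expand)
  qed
  have "f \<in> behavior PT_fin_poly N"
    unfolding behavior_def
  proof (intro CollectI conjI allI ballI)
    show "f $ j \<in> PT_fin_poly" for j by (simp add: f_def nf.signal_fin)
    fix r x
    assume "r \<in> N"
    then have "\<phi> ((shift a x ^ m) *s r) = 0" for m
      using \<open>N \<subseteq> N0\<close> N'(2) by (intro \<phi>(3) submodule_scale[OF N'(1)]) auto
    then show "(\<Sum>j\<in>UNIV. dop_apply (r $ j) (f $ j) x) = 0" by (simp add: apply_f)
  qed
  moreover have "(\<Sum>j\<in>UNIV. dop_apply (v $ j) (f $ j) 0) = 1"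
  proof -
    have "shift a 0 = 0" by (simp add: shift_def)
    then have "(\<Sum>m\<le>K. 1 / fact m * \<phi> ((shift a 0 ^ m) *s v)) = (\<Sum>m\<le>K. if m = 0 then 1 else 0)"
      by (intro sum.cong) (auto simp: \<phi>0 \<phi>(4) power_0_left)
    then show ?thesis by (simp add: apply_f character_def)
  qed
  ultimately show ?thesis by blast
qed

section \<open>The Willems closure\<close>

text \<open>Frequencies are real vectors while varieties lie in complex space; rational points are
  transferred through \<open>of_rat\<close>.\<close>

lemma has_rational_point_variety_iff:
  "has_rational_point (variety P) \<longleftrightarrow> (\<exists>a. (\<forall>j. a $ j \<in> \<rat>) \<and> (\<forall>s\<in>P. ev a s = 0))"
proof
  assume "has_rational_point (variety P)"
  then obtain z where z: "\<forall>s\<in>P. dop_eval s z = 0" "\<forall>j. z $ j \<in> \<rat>"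
    by (auto simp: has_rational_point_def variety_def)
  then have "\<forall>j. \<exists>q. z $ j = of_rat q" by (metis Rats_cases)
  then obtain q where q: "\<And>j. z $ j = of_rat (q j)" by metis
  define a :: "real ^ 'a" where "a = (\<chi> j. of_rat (q j))"
  have "complex_of_real (of_rat x) = of_rat x" for x
    by (cases x) (simp add: Fract_of_int_quotient of_rat_divide)
  then have "z = (\<chi> j. of_real (a $ j))" by (simp add: vec_eq_iff a_def q)
  with z(1) have "(\<forall>j. a $ j \<in> \<rat>) \<and> (\<forall>s\<in>P. ev a s = 0)" by (simp add: ev_def a_def)
  then show "\<exists>a. (\<forall>j. a $ j \<in> \<rat>) \<and> (\<forall>s\<in>P. ev a s = 0)" ..
next
  assume "\<exists>a. (\<forall>j. a $ j \<in> \<rat>) \<and> (\<forall>s\<in>P. ev a s = 0)"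
  then obtain a where a: "\<forall>j. a $ j \<in> \<rat>" "\<forall>s\<in>P. ev a s = 0" by blast
  then show "has_rational_point (variety P)"
    unfolding has_rational_point_def variety_def
    by (intro bexI[of _ "\<chi> j. of_real (a $ j)"]) (auto simp: ev_def)
qed

lemma Willems_closure_subset_primary:
  fixes N :: "('n::finite dop ^ 'q::finite) set"
  assumes "is_primary P N" "has_rational_point (variety P)" "M \<subseteq> N"
  shows "Willems_closure PT_fin_poly M \<subseteq> N"
proof
  fix v
  assume v: "v \<in> Willems_closure PT_fin_poly M"
  show "v \<in> N"
  proof (rule ccontr)
    assume "v \<notin> N"
    obtain a where a: "\<forall>j. a $ j \<in> \<rat>" "\<And>s. s \<in> P \<Longrightarrow> ev a s = 0"
      using assms(2) by (auto simp: has_rational_point_variety_iff)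
    obtain f where f: "f \<in> behavior PT_fin_poly N" "(\<Sum>j\<in>UNIV. dop_apply (v $ j) (f $ j) 0) = 1"
      using primary_separating_signal[OF assms(1) a \<open>v \<notin> N\<close>] by blast
    have "f \<in> behavior PT_fin_poly M" using f(1) assms(3) by (auto simp: behavior_def)
    with v f(2) show False by (simp add: Willems_closure_def behavior_perp_def)
  qed
qed

text \<open>For a signal \<open>f\<close> in the behavior of \<open>M\<close>, pairing with
  \<open>v\<close> gives a scalar signal \<open>w\<close>. Each \<open>s\<close> with
  \<open>s *s v\<close> in \<open>M\<close> annihilates \<open>w\<close>, so such operators at all
  rational points force \<open>w = 0\<close>.\<close>

lemma Willems_closureI:
  fixes M :: "('n::finite dop ^ 'q::finite) set"
  assumes "\<And>a. \<forall>j. a $ j \<in> \<rat> \<Longrightarrow> \<exists>s. ev a s \<noteq> 0 \<and> s *s v \<in> M"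
  shows "v \<in> Willems_closure PT_fin_poly M"
  unfolding Willems_closure_def behavior_perp_def
proof (intro CollectI ballI allI)
  fix f x
  assume f: "f \<in> behavior PT_fin_poly M"
  then have fin: "f $ j \<in> PT_fin_poly" for j by (simp add: behavior_def)
  define w where "w = (\<lambda>x. \<Sum>j\<in>UNIV. dop_apply (v $ j) (f $ j) x)"
  have w: "w \<in> PT_fin_poly" unfolding w_def by (intro PT_fin_poly_sum dop_apply_fin fin)
  have "dop_apply s w = (\<lambda>x. 0)" if "s *s v \<in> M" for s
  proof -
    have "dop_apply s w = (\<lambda>x. \<Sum>j\<in>UNIV. dop_apply ((s *s v) $ j) (f $ j) x)"
      unfolding w_def by (simp add: dop_apply_sum_fun dop_apply_fin fin dop_apply_mult)
    also have "\<dots> = (\<lambda>x. 0)" using f that unfolding behavior_def by blast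
    finally show ?thesis .
  qed
  with assms have "w = (\<lambda>x. 0)"
    by (intro zero_if_annihilator_avoids_rational_points[OF w]) blast
  then show "(\<Sum>j\<in>UNIV. dop_apply (v $ j) (f $ j) x) = 0"
    unfolding w_def by (rule fun_cong)
qed

theorem theorem4p1:
  fixes M :: "('n::finite dop ^ 'q::finite) set"
    and Mi :: "nat \<Rightarrow> ('n dop ^ 'q) set"
    and p :: "nat \<Rightarrow> 'n dop set"
    and r t :: nat
  assumes "CARD('n) \<ge> 2"
    and "is_submodule M"
    and "irredundant_primary_decomposition M t Mi p"
    and "r \<le> t"
    and "\<forall>i\<in>{1..r}. has_rational_point (variety (p i))"
    and "\<forall>i\<in>{r+1..t}. \<not> has_rational_point (variety (p i))"
  shows "Willems_closure PT_fin_poly M = (\<Inter>i\<in>{1..r}. Mi i) \<and>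
    (M = Willems_closure PT_fin_poly M \<longleftrightarrow>
      (\<forall>i\<in>{1..t}. has_rational_point (variety (p i))))"
proof -
  have M: "M = (\<Inter>i\<in>{1..t}. Mi i)"
    and prim: "\<And>i. i \<in> {1..t} \<Longrightarrow> is_primary (p i) (Mi i)"
    and irr: "\<And>k. k \<in> {1..t} \<Longrightarrow> (\<Inter>i\<in>{1..t} - {k}. Mi i) \<noteq> M"
    using assms(3) unfolding irredundant_primary_decomposition_def by blast+
  have closure: "Willems_closure PT_fin_poly M = (\<Inter>i\<in>{1..r}. Mi i)"
  proof
    show "Willems_closure PT_fin_poly M \<subseteq> (\<Inter>i\<in>{1..r}. Mi i)"
    proof (rule INT_greatest)
      fix i
      assume i: "i \<in> {1..r}"
      with assms(4) have "i \<in> {1..t}" by auto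
      then show "Willems_closure PT_fin_poly M \<subseteq> Mi i"
        using i assms(5) by (intro Willems_closure_subset_primary[OF prim]) (auto simp: M)
    qed
    show "(\<Inter>i\<in>{1..r}. Mi i) \<subseteq> Willems_closure PT_fin_poly M"
    proof
      fix v
      assume v: "v \<in> (\<Inter>i\<in>{1..r}. Mi i)"
      show "v \<in> Willems_closure PT_fin_poly M"
      proof (rule Willems_closureI)
        fix a :: "real ^ 'n"
        assume a: "\<forall>j. a $ j \<in> \<rat>"
        \<comment> \<open>For \<open>i\<close> up to \<open>r\<close> the multiplier 1 works. Beyond
          \<open>r\<close>, some element of \<open>p i\<close> is nonzero at \<open>a\<close>, and a
          power of it carries \<open>v\<close> into \<open>Mi i\<close>. The product over all
          \<open>i\<close> then carries \<open>v\<close> into \<open>M\<close>.\<close>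
        have "\<exists>s. ev a s \<noteq> 0 \<and> s *s v \<in> Mi i" if i: "i \<in> {1..t}" for i
        proof (cases "i \<le> r")
          case True
          then show ?thesis using v i ev_scal[of a 1] by (intro exI[of _ 1]) simp
        next
          case False
          then have "i \<in> {r+1..t}" using i by simp
          then obtain s where s: "s \<in> p i" "ev a s \<noteq> 0"
            using assms(6) a unfolding has_rational_point_variety_iff by blast
          obtain k where "s ^ k *s v \<in> Mi i" using primary_power_in[OF prim[OF i] s(1)] by blast
          moreover have "ev a (s ^ k) \<noteq> 0"
            using s(2) ev_scal[of a 1] by (induction k) (simp_all add: ev_mult[OF a])
          ultimately show ?thesis by blast
        qed
        then obtain s where s: "\<And>i. i \<in> {1..t} \<Longrightarrow> ev a (s i) \<noteq> 0 \<and> s i *s v \<in> Mi i" by metis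
        have "ev a (\<Prod>i\<in>A. s i) \<noteq> 0" if "A \<subseteq> {1..t}" for A
          using finite_subset[OF that finite_atLeastAtMost] that
        proof (induction A rule: finite_induct)
          case empty
          show ?case using ev_scal[of a 1] by simp
        next
          case (insert i A)
          then show ?case using s[of i] by (simp add: ev_mult[OF a])
        qed
        moreover have "(\<Prod>i\<in>{1..t}. s i) *s v \<in> Mi i" if i: "i \<in> {1..t}" for i
        proof -
          have "is_submodule (Mi i)" using prim[OF i] by (simp add: is_primary_def)
          from submodule_scale[OF this conjunct2[OF s[OF i]], of "\<Prod>i\<in>{1..t} - {i}. s i"]
          moreover have "(\<Prod>i\<in>{1..t}. s i) = (\<Prod>i\<in>{1..t} - {i}. s i) * s i"
            using i by (subst prod.remove[of _ i]) (simp_all add: mult.commute)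
          ultimately show ?thesis by (simp only: vector_smult_assoc)
        qed
        ultimately show "\<exists>s. ev a s \<noteq> 0 \<and> s *s v \<in> M" unfolding M by blast
      qed
    qed
  qed
  have "M = Willems_closure PT_fin_poly M \<longleftrightarrow> (\<forall>i\<in>{1..t}. has_rational_point (variety (p i)))"
  proof
    assume eq: "M = Willems_closure PT_fin_poly M"
    show "\<forall>i\<in>{1..t}. has_rational_point (variety (p i))"
    proof (rule ballI, rule ccontr)
      fix k
      assume k: "k \<in> {1..t}" "\<not> has_rational_point (variety (p k))"
      \<comment> \<open>An index without a rational point lies beyond \<open>r\<close>. If
        \<open>M\<close> is closed, omitting its component leaves the intersection inside
        \<open>M\<close>, against irredundance.\<close>
      then have "{1..r} \<subseteq> {1..t} - {k}" using assms(4,5) by auto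
      then have "(\<Inter>i\<in>{1..t} - {k}. Mi i) \<subseteq> (\<Inter>i\<in>{1..r}. Mi i)"
        by (rule INT_anti_mono) simp
      then have "(\<Inter>i\<in>{1..t} - {k}. Mi i) \<subseteq> M"
        unfolding trans[OF eq closure, symmetric] .
      moreover have "M \<subseteq> (\<Inter>i\<in>{1..t} - {k}. Mi i)" unfolding M by blast
      ultimately show False using irr[OF k(1)] by blast
    qed
  next
    assume all: "\<forall>i\<in>{1..t}. has_rational_point (variety (p i))"
    have "r = t"
    proof (rule ccontr)
      assume "r \<noteq> t"
      with assms(4) have "t \<in> {r+1..t}" "t \<in> {1..t}" by auto
      with all assms(6) show False by blast
    qed
    with M closure show "M = Willems_closure PT_fin_poly M" by (simp only:)
  qed
  with closure show ?thesis ..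
qed

end
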